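(* Let $\mu$ and $\nu$ be two orthogonal (mutually singular) probability measures on $\mathbb{R}$, and let $(B_t:t\in\mathbb{R})$ be a two-sided Brownian motion with $B_0\sim\mu$ under $\mathbb{P}_\mu$. Then every non-negative unbiased shift $T$ with $B_T\sim\nu$ satisfies $$\mathbb{E}_\mu\, T^{1/4}=\infty .$$
   Context: $\mathbb{P}_\mu,\mathbb{E}_\mu$ denote probability and expectation on a probability space supporting a two-sided Brownian motion $(B_t:t\in\mathbb{R})$ with $B_0\sim\mu$, i.e. $B_t=B_0+W_t$ where $(W_t:t\ge 0)$ and $(W_{-t}:t\ge0)$ are independent standard Brownian motions started at $0$, independent of $B_0$; the space may carry additional randomness. A (real-valued) random time $T$ on such a space is an unbiased shift if $(B_{T+t}:t\in\mathbb{R})$ is again a two-sided Brownian motion (i.e. $B_T$ is independent of $(B_{T+t}-B_T)_{t\in\mathbb{R}}$, and the latter is a two-sided standard Brownian motion taking value $0$ at time $0$). $T$ is not required to be a stopping time, nor to be measurable with respect to $B$. *)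

theory Defs
  imports "HOL-Probability.Probability"
begin

definition mutually_singular :: "'a measure \<Rightarrow> 'a measure \<Rightarrow> bool" where
  "mutually_singular \<mu> \<nu> \<longleftrightarrow> sets \<mu> = sets \<nu> \<and>
    (\<exists>A\<in>sets \<mu>. emeasure \<mu> A = 0 \<and> emeasure \<nu> (space \<nu> - A) = 0)"

context prob_space
begin

(* The library's indep_var forces both random elements to have the same value type;
   this is the same notion for random elements of different types. *)
definition indep_rv :: "'b measure \<Rightarrow> ('a \<Rightarrow> 'b) \<Rightarrow> 'c measure \<Rightarrow> ('a \<Rightarrow> 'c) \<Rightarrow> bool" where
  "indep_rv N X N' Y \<longleftrightarrow> random_variable N X \<and> random_variable N' Y \<and>
    indep_set (sigma_sets (space M) {X -` A \<inter> space M | A. A \<in> sets N})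
              (sigma_sets (space M) {Y -` A \<inter> space M | A. A \<in> sets N'})"

(* Standard Brownian motion started at 0, with time set {0..}; values of X at negative
   times are ignored. *)
definition standard_brownian_motion :: "(real \<Rightarrow> 'a \<Rightarrow> real) \<Rightarrow> bool" where
  "standard_brownian_motion X \<longleftrightarrow>
    (\<forall>t\<ge>0. random_variable borel (X t)) \<and>
    (AE \<omega> in M. X 0 \<omega> = 0) \<and>
    (\<forall>s t. 0 \<le> s \<and> s < t \<longrightarrow>
      distributed M lborel (\<lambda>\<omega>. X t \<omega> - X s \<omega>) (normal_density 0 (sqrt (t - s)))) \<and>
    (\<forall>(n::nat) (\<tau>::nat \<Rightarrow> real). 0 \<le> \<tau> 0 \<and> mono \<tau> \<longrightarrow>
      indep_vars (\<lambda>_. borel) (\<lambda>i \<omega>. X (\<tau> (Suc i)) \<omega> - X (\<tau> i) \<omega>) {..<n}) \<and>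
    (AE \<omega> in M. continuous_on {0..} (\<lambda>t. X t \<omega>))"

definition two_sided_standard_brownian_motion :: "(real \<Rightarrow> 'a \<Rightarrow> real) \<Rightarrow> bool" where
  "two_sided_standard_brownian_motion W \<longleftrightarrow>
    standard_brownian_motion W \<and>
    standard_brownian_motion (\<lambda>t. W (- t)) \<and>
    indep_rv (PiM {0..} (\<lambda>_. borel)) (\<lambda>\<omega>. \<lambda>t\<in>{0..}. W t \<omega>)
             (PiM {0..} (\<lambda>_. borel)) (\<lambda>\<omega>. \<lambda>t\<in>{0..}. W (- t) \<omega>)"

(* Arbitrary initial law: the law of B 0 is left unspecified. *)
definition two_sided_brownian_motion :: "(real \<Rightarrow> 'a \<Rightarrow> real) \<Rightarrow> bool" where
  "two_sided_brownian_motion B \<longleftrightarrow>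
    indep_rv borel (B 0) (PiM UNIV (\<lambda>_. borel)) (\<lambda>\<omega> t. B t \<omega> - B 0 \<omega>) \<and>
    two_sided_standard_brownian_motion (\<lambda>t \<omega>. B t \<omega> - B 0 \<omega>)"

(* T is measurable only with respect to the ambient space M, which may carry more
   randomness than B. *)
definition unbiased_shift :: "(real \<Rightarrow> 'a \<Rightarrow> real) \<Rightarrow> ('a \<Rightarrow> real) \<Rightarrow> bool" where
  "unbiased_shift B T \<longleftrightarrow>
    random_variable borel T \<and>
    two_sided_brownian_motion (\<lambda>t \<omega>. B (T \<omega> + t) \<omega>)"

end

end

theory Submission
  imports Defs
begin

text \<open>
  The fluctuations of Brownian motion force the transport of the mass \<open>\<mu>\<close> to the mass \<open>\<nu>\<close> to be slow: in a time
  window of length \<open>t\<close> the local times of \<open>B\<close> weighted by \<open>\<mu>\<close> and by \<open>\<nu>\<close> typically differ by an amount of order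
  \<open>t powr (1/4)\<close>, and the surplus has to be carried out of the window. Quantitatively, let \<open>\<Psi>\<close> be a bounded functional
  of the path in a window of length \<open>t\<close>, and integrate it over the starting times of all windows that contain the
  time \<open>0\<close>, respectively the time \<open>T\<close>. The two ranges of starting times agree except for two pieces of length
  \<open>min T t\<close>, so the integrals differ by at most \<open>2 sup \<bar>\<Psi>\<bar> min T t\<close> (\<open>shift_comparison\<close>). The means of the integrals
  depend only on the laws \<open>\<mu>\<close> of \<open>B 0\<close> and \<open>\<nu>\<close> of \<open>B T\<close>, since \<open>B\<close> and the shifted path are both two-sided
  Brownian motions. A functional for which the means differ by at least a constant times \<open>t powr (3/4)\<close> therefore gives
  \<open>E (min T t) \<ge> const * t powr (3/4)\<close>; but if \<open>T powr (1/4)\<close> were integrable, dominated convergence would give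
  \<open>E (min T t) = o(t powr (3/4))\<close>.

  The functional stands in for \<open>exp (i \<epsilon> D)\<close>, where \<open>D\<close> is the local time difference and \<open>\<epsilon>\<close> is of order
  \<open>t powr (-1/4)\<close>. Local times are avoided by sampling the path on a grid of mesh \<open>\<delta>\<close>. With \<open>P\<close> the averaging over
  a centred Gaussian of variance \<open>\<delta>\<close>, the random variables \<open>\<phi> (B\<^sub>n) * (\<Prod>k<n. \<phi> (B\<^sub>k) / P \<phi> (B\<^sub>k))\<close> form a martingale
  whenever \<open>P \<phi>\<close> has no zero. Used to the right and to the left of a time in the window, this identity shows that the
  window functional has mean \<open>\<integral> P\<^sub>r \<phi> * P\<^sub>s \<phi> d\<mu>\<close> with \<open>r + s = \<delta>\<close> (\<open>window_expectation\<close>), where \<open>P\<^sub>r\<close> is the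
  averaging with variance \<open>r\<close>.

  It remains to choose \<open>\<phi> = c * exp (i \<epsilon> f)\<close>. Here \<open>f\<close> is a Lipschitz function with different integrals under \<open>\<mu>\<close>
  and \<open>\<nu>\<close>, so that the imaginary parts of the two means differ by a multiple of \<open>\<epsilon>\<close>. The amplitude \<open>c\<close>, close to \<open>1\<close>,
  keeps the product of \<open>m\<close> weights bounded: averaging an oscillating function over a Gaussian loses modulus of order
  \<open>\<epsilon>\<^sup>2\<close> near the support of \<open>f\<close>, and subtracting from \<open>1\<close> a small multiple of the truncated potential \<open>\<Sum>k<m. P\<^sup>k f\<close>
  compensates this loss up to a factor \<open>1 - 1/m\<close> (\<open>exists_damping\<close>). In one dimension this potential grows like
  \<open>sqrt m\<close>, and this is what permits \<open>\<epsilon>\<close> to be as large as a constant times \<open>m powr (-1/4)\<close>.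
\<close>

section \<open>The Gaussian averaging operator\<close>

definition gauss :: "real \<Rightarrow> real measure" where
  "gauss r = density lborel (\<lambda>x. ennreal (normal_density 0 (sqrt r) x))"

text \<open>
  The heat semigroup at time \<open>r\<close>, for real and for complex functions.
\<close>
definition heat :: "real \<Rightarrow> (real \<Rightarrow> 'b::{banach, second_countable_topology}) \<Rightarrow> real \<Rightarrow> 'b" where
  "heat r f x = (\<integral>y. f (x + y) \<partial>gauss r)"

lemma sets_gauss [measurable_cong, simp]: "sets (gauss r) = sets borel"
  by (simp add: gauss_def)

lemma space_gauss [simp]: "space (gauss r) = UNIV"
  by (simp add: gauss_def)

lemma prob_space_gauss: "0 < r \<Longrightarrow> prob_space (gauss r)"
  unfolding gauss_def by (rule prob_space_normal_density) simp

lemma (in finite_measure) integrable_bounded: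
  fixes f :: "'a \<Rightarrow> 'b::{banach, second_countable_topology}"
  assumes "f \<in> borel_measurable M" "\<And>x. norm (f x) \<le> C"
  shows "integrable M f"
  using assms by (intro integrable_const_bound[where B = C]) auto

lemma measurable_heat [measurable]:
  fixes f :: "real \<Rightarrow> 'b::{banach, second_countable_topology}"
  assumes "0 < r" and [measurable]: "f \<in> borel_measurable borel"
  shows "heat r f \<in> borel_measurable borel"
proof -
  interpret prob_space "gauss r" using assms(1) by (rule prob_space_gauss)
  show ?thesis unfolding heat_def [abs_def] by measurable
qed

lemma integrable_gauss:
  fixes f :: "real \<Rightarrow> 'b::{banach, second_countable_topology}"
  assumes "0 < r" and [measurable]: "f \<in> borel_measurable borel" and "\<And>x. norm (f x) \<le> C"
  shows "integrable (gauss r) (\<lambda>y. f (x + y))"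
proof -
  interpret prob_space "gauss r" using assms(1) by (rule prob_space_gauss)
  show ?thesis using assms(3) by (intro integrable_bounded[where C = C]) auto
qed

lemma norm_heat_le:
  fixes f :: "real \<Rightarrow> 'b::{banach, second_countable_topology}"
  assumes "0 < r" "f \<in> borel_measurable borel" "\<And>x. norm (f x) \<le> C"
  shows "norm (heat r f x) \<le> C"
proof -
  interpret prob_space "gauss r" using assms(1) by (rule prob_space_gauss)
  have "norm (heat r f x) \<le> (\<integral>y. norm (f (x + y)) \<partial>gauss r)"
    unfolding heat_def by (rule integral_norm_bound)
  also have "\<dots> \<le> (\<integral>y. C \<partial>gauss r)"
    using assms by (intro integral_mono integrable_norm integrable_gauss) auto
  also have "\<dots> = C"
    using prob_space by simp
  finally show ?thesis .
qed

lemma heat_const: "0 < r \<Longrightarrow> heat r (\<lambda>x. c) x = c"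
  using prob_space.prob_space[OF prob_space_gauss, of r] by (simp add: heat_def)

lemma heat_add:
  fixes f g :: "real \<Rightarrow> real"
  assumes "0 < r" "f \<in> borel_measurable borel" "g \<in> borel_measurable borel"
    "\<And>x. \<bar>f x\<bar> \<le> C" "\<And>x. \<bar>g x\<bar> \<le> D"
  shows "heat r (\<lambda>x. f x + g x) x = heat r f x + heat r g x"
  unfolding heat_def using assms
  by (intro Bochner_Integration.integral_add integrable_gauss[where C = C] integrable_gauss[where C = D]) auto

lemma heat_cmult:
  fixes f :: "real \<Rightarrow> real"
  shows "heat r (\<lambda>x. a * f x) x = a * heat r f x"
  unfolding heat_def by simp

text \<open>
  The heat kernel is at most \<open>1 / sqrt (2 * pi * r)\<close>. This decay is not summable in the time, and the partial
  sums over a grid grow like a square root; the exponent \<open>1/4\<close> of the theorem comes from here.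
\<close>
lemma heat_le_kernel_bound:
  fixes f :: "real \<Rightarrow> real"
  assumes r: "0 < r" and f: "integrable lborel f" "\<And>x. 0 \<le> f x"
  shows "heat r f x \<le> (\<integral>x. f x \<partial>lborel) / sqrt (2 * pi * r)"
proof -
  have [measurable]: "f \<in> borel_measurable borel" using f(1) by auto
  have int: "integrable lborel (\<lambda>y. f (x + y))"
    using lborel_integrable_real_affine[OF f(1), of 1 x] by simp
  have le: "normal_density 0 (sqrt r) y \<le> 1 / sqrt (2 * pi * r)" for y
    using r by (simp add: normal_density_def divide_simps)
  have "heat r f x = (\<integral>y. normal_density 0 (sqrt r) y * f (x + y) \<partial>lborel)"
    unfolding heat_def gauss_def by (subst integral_density) auto
  also have "\<dots> \<le> (\<integral>y. f (x + y) * (1 / sqrt (2 * pi * r)) \<partial>lborel)"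
  proof (rule integral_mono)
    show 2: "integrable lborel (\<lambda>y. f (x + y) * (1 / sqrt (2 * pi * r)))"
      using int by (rule integrable_mult_left)
    show "normal_density 0 (sqrt r) y * f (x + y) \<le> f (x + y) * (1 / sqrt (2 * pi * r))" for y
      using mult_right_mono[OF le[of y] f(2)[of "x + y"]] by (simp add: ac_simps)
    then show "integrable lborel (\<lambda>y. normal_density 0 (sqrt r) y * f (x + y))"
      using r by (intro Bochner_Integration.integrable_bound[OF 2]) (auto simp: abs_mult f(2))
  qed
  also have "\<dots> = (\<integral>y. f (x + y) \<partial>lborel) / sqrt (2 * pi * r)"
    by simp
  also have "(\<integral>y. f (x + y) \<partial>lborel) = (\<integral>x. f x \<partial>lborel)"
    using lborel_integral_real_affine[of 1 f x] by simp
  finally show ?thesis .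
qed

lemma convolution_gauss:
  assumes "0 < r" "0 < s"
  shows "convolution (gauss r) (gauss s) = gauss (r + s)"
proof -
  have "convolution (gauss r) (gauss s) = density lborel
      (\<lambda>x. \<integral>\<^sup>+y. ennreal (normal_density 0 (sqrt r) (x - y)) * ennreal (normal_density 0 (sqrt s) y) \<partial>lborel)"
    unfolding gauss_def
    using assms prob_space_gauss[of r] prob_space_gauss[of s]
    by (intro convolution_density) (auto simp: gauss_def prob_space_def)
  also have "\<dots> = gauss (r + s)"
    unfolding gauss_def using conv_normal_density_zero_mean[of "sqrt r" "sqrt s"] assms
    by (simp add: ennreal_mult[symmetric])
  finally show ?thesis .
qed

lemma heat_heat:
  fixes f :: "real \<Rightarrow> real"
  assumes r: "0 < r" "0 < s" and [measurable]: "f \<in> borel_measurable borel" and C: "\<And>x. norm (f x) \<le> C"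
  shows "heat r (heat s f) x = heat (r + s) f x"
proof -
  interpret R: prob_space "gauss r" using r(1) by (rule prob_space_gauss)
  interpret S: prob_space "gauss s" using r(2) by (rule prob_space_gauss)
  interpret RS: pair_prob_space "gauss r" "gauss s" ..
  have int: "integrable (gauss r \<Otimes>\<^sub>M gauss s) (\<lambda>(y, z). f (x + (y + z)))"
    using C by (intro RS.P.integrable_bounded[where C = C]) auto
  have "heat (r + s) f x = (\<integral>y. f (x + y) \<partial>distr (gauss r \<Otimes>\<^sub>M gauss s) borel (\<lambda>(x, y). x + y))"
    unfolding heat_def convolution_gauss[OF r, symmetric] convolution_def ..
  also have "\<dots> = (\<integral>p. (case p of (y, z) \<Rightarrow> f (x + (y + z))) \<partial>(gauss r \<Otimes>\<^sub>M gauss s))"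
    by (subst integral_distr) (auto simp: case_prod_unfold)
  also have "\<dots> = (\<integral>y. (\<integral>z. f (x + (y + z)) \<partial>gauss s) \<partial>gauss r)"
    using RS.integral_fst'[OF int] by simp
  also have "\<dots> = heat r (heat s f) x"
    by (simp add: heat_def add.assoc)
  finally show ?thesis ..
qed

text \<open>
  A centred Gaussian of variance \<open>r\<close> has mean absolute value \<open>sqrt (2 * r / pi)\<close>, which is at most \<open>sqrt r\<close>.
\<close>
lemma heat_Lipschitz_approx:
  fixes f :: "real \<Rightarrow> real"
  assumes r: "0 < r" and [measurable]: "f \<in> borel_measurable borel" and C: "\<And>x. \<bar>f x\<bar> \<le> C"
    and L: "\<And>x y. \<bar>f x - f y\<bar> \<le> L * \<bar>x - y\<bar>"
  shows "\<bar>heat r f x - f x\<bar> \<le> L * sqrt r"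
proof -
  interpret R: prob_space "gauss r" using r by (rule prob_space_gauss)
  have "0 \<le> L" using L[of 0 1] by auto
  have m: "has_bochner_integral lborel (\<lambda>y. normal_density 0 (sqrt r) y * \<bar>y\<bar>) (sqrt r * sqrt (2 / pi))"
    using normal_moment_abs_odd[of "sqrt r" 0 0] r by simp
  have int: "integrable (gauss r) (\<lambda>y. \<bar>y\<bar>)"
    unfolding gauss_def using m by (subst integrable_density) (auto simp: has_bochner_integral_iff)
  have "(\<integral>y. \<bar>y\<bar> \<partial>gauss r) = sqrt r * sqrt (2 / pi)"
    unfolding gauss_def using m by (subst integral_density) (auto simp: has_bochner_integral_iff)
  also have "\<dots> \<le> sqrt r * 1"
    using r pi_ge_two by (intro mult_left_mono) auto
  finally have le: "(\<integral>y. \<bar>y\<bar> \<partial>gauss r) \<le> sqrt r" by simp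
  have i1: "integrable (gauss r) (\<lambda>y. f (x + y))"
    using r C by (intro integrable_gauss[where C = C]) auto
  have "heat r f x - f x = (\<integral>y. f (x + y) - f x \<partial>gauss r)"
    unfolding heat_def using i1 using R.prob_space by simp
  also have "\<bar>\<dots>\<bar> \<le> (\<integral>y. \<bar>f (x + y) - f x\<bar> \<partial>gauss r)"
    by (rule integral_abs_bound)
  also have "\<dots> \<le> (\<integral>y. L * \<bar>y\<bar> \<partial>gauss r)"
    using i1 int L[of "x + _" x] by (intro integral_mono) auto
  also have "\<dots> = L * (\<integral>y. \<bar>y\<bar> \<partial>gauss r)" by simp
  also have "\<dots> \<le> L * sqrt r"
    using le \<open>0 \<le> L\<close> by (rule mult_left_mono)
  finally show ?thesis .
qed

section \<open>Multiplicative functionals of Brownian motion sampled on a grid\<close>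

text \<open>
  For \<open>w = \<phi> / P \<phi>\<close> and a random walk \<open>y\<close> with transition operator \<open>P\<close> this is a martingale in \<open>k\<close>.
\<close>
definition chain :: "(real \<Rightarrow> complex) \<Rightarrow> (real \<Rightarrow> complex) \<Rightarrow> nat \<Rightarrow> (nat \<Rightarrow> real) \<Rightarrow> complex" where
  "chain w \<phi> k y = (\<Prod>i<k. w (y i)) * \<phi> (y k)"

lemma chain_cong: "(\<And>i. i \<le> k \<Longrightarrow> y i = z i) \<Longrightarrow> chain w \<phi> k y = chain w \<phi> k z"
  by (auto simp: chain_def intro!: arg_cong2[where f = "(*)"] prod.cong)

lemma measurable_chain:
  assumes [measurable]: "w \<in> borel_measurable borel" "\<phi> \<in> borel_measurable borel"
    and "\<And>i. i \<le> k \<Longrightarrow> (\<lambda>z. Y z i) \<in> borel_measurable N"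
  shows "(\<lambda>z. chain w \<phi> k (Y z)) \<in> borel_measurable N"
proof -
  have 1: "(\<lambda>z. w (Y z i)) \<in> borel_measurable N" if "i < k" for i
    using measurable_compose[OF assms(3) assms(1)] that by simp
  have 2: "(\<lambda>z. \<phi> (Y z k)) \<in> borel_measurable N"
    using measurable_compose[OF assms(3) assms(2)] by simp
  show ?thesis
    unfolding chain_def using 1 2 by (intro borel_measurable_times borel_measurable_prod) auto
qed

lemma norm_chain_le:
  assumes "\<And>x. norm (w x) \<le> K" "\<And>x. norm (\<phi> x) \<le> 1"
  shows "norm (chain w \<phi> k y) \<le> K ^ k"
proof -
  have "norm (\<Prod>i<k. w (y i)) \<le> (\<Prod>i<k. K)"
    unfolding prod_norm[symmetric] using assms(1) by (intro prod_mono) auto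
  then have "norm (\<Prod>i<k. w (y i)) \<le> K ^ k" by simp
  moreover have "0 \<le> K" using assms(1)[of 0] norm_ge_zero[of "w 0"] by linarith
  ultimately show ?thesis
    unfolding chain_def norm_mult using mult_mono[of _ "K ^ k" "norm (\<phi> (y k))" 1] assms(2)[of "y k"]
    by simp
qed

text \<open>
  Integrating out the last increment replaces \<open>\<phi> (y (Suc k))\<close> by \<open>P \<phi> (y k)\<close>, and the last weight turns this
  back into \<open>\<phi> (y k)\<close>. So the mean does not depend on \<open>k\<close>. The first increment has its own variance \<open>v 0\<close>
  because the time \<open>0\<close> does not lie on the grid.
\<close>
lemma chain_integral_PiM:
  fixes v :: "nat \<Rightarrow> real"
  assumes v: "\<And>i. 0 < v i" "\<And>i. v (Suc i) = \<delta>"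
    and [measurable]: "w \<in> borel_measurable borel" "\<phi> \<in> borel_measurable borel"
    and K: "\<And>x. norm (w x) \<le> K" "\<And>x. norm (\<phi> x) \<le> 1"
    and harm: "\<And>x. w x * heat \<delta> \<phi> x = \<phi> x"
  shows "(\<integral>d. chain w \<phi> k (\<lambda>i. x + (\<Sum>j\<le>i. d j)) \<partial>PiM {..k} (\<lambda>i. gauss (v i))) = heat (v 0) \<phi> x"
proof (induction k)
  interpret product_prob_space "\<lambda>i. gauss (v i)" UNIV
    by (intro product_prob_spaceI prob_space_gauss v)
  {
    case 0
    have "(\<integral>d. chain w \<phi> 0 (\<lambda>i. x + (\<Sum>j\<le>i. d j)) \<partial>PiM {..0} (\<lambda>i. gauss (v i)))
      = (\<integral>d. \<phi> (x + d 0) \<partial>PiM {0} (\<lambda>i. gauss (v i)))"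
      by (simp add: chain_def atMost_0)
    also have "\<dots> = heat (v 0) \<phi> x"
      unfolding heat_def by (rule product_integral_singleton) simp
    finally show ?case .
  next
    case (Suc k)
    let ?Y = "\<lambda>d i. x + (\<Sum>j\<le>i. d j) :: real"
    let ?P = "\<lambda>k. PiM {..k} (\<lambda>i. gauss (v i))"
    interpret Q: prob_space "?P (Suc k)"
      by (intro prob_space_PiM prob_space_gauss v)
    have int: "integrable (?P (Suc k)) (\<lambda>d. chain w \<phi> (Suc k) (?Y d))"
    proof (rule Q.integrable_bounded)
      show "(\<lambda>d. chain w \<phi> (Suc k) (?Y d)) \<in> borel_measurable (?P (Suc k))"
        by (intro measurable_chain borel_measurable_add borel_measurable_sum)
          (auto intro!: measurable_compose[OF measurable_component_singleton, of _ _ "\<lambda>i. gauss (v i)" "\<lambda>x. x"])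
    qed (rule norm_chain_le[OF K])
    have 1: "(\<integral>y. chain w \<phi> (Suc k) (?Y (d(Suc k := y))) \<partial>gauss (v (Suc k))) = chain w \<phi> k (?Y d)" for d
    proof -
      have s: "(\<Sum>j\<le>i. (d(Suc k := y)) j) = (\<Sum>j\<le>i. d j)" if "i \<le> k" for i y
        using that by (intro sum.cong) auto
      have "chain w \<phi> (Suc k) (?Y (d(Suc k := y))) = (\<Prod>i<Suc k. w (?Y d i)) * \<phi> (?Y d k + y)" for y
        unfolding chain_def using s by (auto intro!: arg_cong2[where f = "(*)"] prod.cong simp: add.assoc)
      then have "(\<integral>y. chain w \<phi> (Suc k) (?Y (d(Suc k := y))) \<partial>gauss (v (Suc k)))
          = (\<Prod>i<Suc k. w (?Y d i)) * heat \<delta> \<phi> (?Y d k)"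
        by (simp add: heat_def v)
      also have "\<dots> = chain w \<phi> k (?Y d)"
        by (simp add: chain_def mult.assoc harm)
      finally show ?thesis .
    qed
    have "integral\<^sup>L (?P (Suc k)) (\<lambda>d. chain w \<phi> (Suc k) (?Y d)) =
        (\<integral>d. (\<integral>y. chain w \<phi> (Suc k) (?Y (d(Suc k := y))) \<partial>gauss (v (Suc k))) \<partial>?P k)"
      using int unfolding atMost_Suc by (intro product_integral_insert) auto
    then show ?case
      unfolding 1 Suc .
  }
qed

context prob_space
begin

lemma brownian_chain_expectation:
  assumes W: "standard_brownian_motion W" and s: "0 < s" "0 < \<delta>"
    and [measurable]: "w \<in> borel_measurable borel" "\<phi> \<in> borel_measurable borel"
    and K: "\<And>x. norm (w x) \<le> K" "\<And>x. norm (\<phi> x) \<le> 1"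
    and harm: "\<And>x. w x * heat \<delta> \<phi> x = \<phi> x"
  shows "(\<integral>\<omega>. chain w \<phi> k (\<lambda>i. x + W (s + i * \<delta>) \<omega>) \<partial>M) = heat s \<phi> x"
proof -
  define \<tau> where "\<tau> i = (case i of 0 \<Rightarrow> 0 | Suc j \<Rightarrow> s + j * \<delta>)" for i
  define v where "v i = (case i of 0 \<Rightarrow> s | Suc j \<Rightarrow> \<delta>)" for i :: nat
  define D where "D i \<omega> = W (\<tau> (Suc i)) \<omega> - W (\<tau> i) \<omega>" for i \<omega>
  have v: "0 < v i" "v (Suc i) = \<delta>" "v 0 = s" for i
    using s by (auto simp: v_def split: nat.split)
  have step: "\<tau> (Suc i) - \<tau> i = v i" for i
    by (auto simp: \<tau>_def v_def algebra_simps split: nat.split)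
  have "\<tau> i \<le> \<tau> (Suc i)" for i
    using step[of i] v(1)[of i] by linarith
  then have mono: "mono \<tau>"
    by (blast intro: monoI lift_Suc_mono_le[of \<tau>])
  have \<tau>0: "0 \<le> \<tau> i" for i
    using s by (auto simp: \<tau>_def split: nat.split)
  have mW: "W t \<in> borel_measurable M" if "0 \<le> t" for t
    using W that unfolding standard_brownian_motion_def by blast
  have meas: "D i \<in> borel_measurable M" for i
    unfolding D_def [abs_def] by (intro borel_measurable_diff mW \<tau>0)
  have law: "distr M borel (D i) = gauss (v i)" for i
  proof -
    have "\<tau> i < \<tau> (Suc i)" using step[of i] v(1)[of i] by linarith
    then have "distributed M lborel (D i) (normal_density 0 (sqrt (v i)))"
      using W \<tau>0[of i] unfolding standard_brownian_motion_def D_def [abs_def] step[symmetric] by blast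
    then have "distr M lborel (D i) = gauss (v i)"
      unfolding gauss_def by (rule distributed_distr_eq_density)
    moreover have "distr M borel (D i) = distr M lborel (D i)"
      by (rule distr_cong) auto
    ultimately show ?thesis by simp
  qed
  have "indep_vars (\<lambda>_. borel) D {..k}"
    using W mono \<tau>0[of 0] unfolding standard_brownian_motion_def D_def [abs_def] lessThan_Suc_atMost[symmetric]
    by blast
  then have "distr M (\<Pi>\<^sub>M i\<in>{..k}. borel) (\<lambda>\<omega>. \<lambda>i\<in>{..k}. D i \<omega>) = (\<Pi>\<^sub>M i\<in>{..k}. distr M borel (D i))"
    using meas by (subst (asm) indep_vars_iff_distr_eq_PiM) auto
  then have joint: "distr M (\<Pi>\<^sub>M i\<in>{..k}. borel) (\<lambda>\<omega>. \<lambda>i\<in>{..k}. D i \<omega>) = PiM {..k} (\<lambda>i. gauss (v i))"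
    by (simp add: law)
  have "AE \<omega> in M. W 0 \<omega> = 0"
    using W unfolding standard_brownian_motion_def by blast
  then have AE: "AE \<omega> in M. chain w \<phi> k (\<lambda>i. x + W (s + i * \<delta>) \<omega>)
      = chain w \<phi> k (\<lambda>i. x + (\<Sum>j\<le>i. (\<lambda>i\<in>{..k}. D i \<omega>) j))"
  proof eventually_elim
    case (elim \<omega>)
    have "W (s + i * \<delta>) \<omega> = (\<Sum>j\<le>i. D j \<omega>)" for i
    proof -
      have "(\<Sum>j\<le>i. D j \<omega>) = W (\<tau> (Suc i)) \<omega> - W (\<tau> 0) \<omega>"
        unfolding D_def lessThan_Suc_atMost[symmetric] by (rule sum_lessThan_telescope)
      then show ?thesis using elim by (simp add: \<tau>_def)
    qed
    then show ?case
      by (intro chain_cong) (auto intro!: sum.cong)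
  qed
  have m: "(\<lambda>d. chain w \<phi> k (\<lambda>i. x + (\<Sum>j\<le>i. d j))) \<in> borel_measurable (\<Pi>\<^sub>M i\<in>{..k}. borel)"
    by (intro measurable_chain borel_measurable_add borel_measurable_sum)
       (auto intro!: measurable_component_singleton)
  have m2: "(\<lambda>\<omega>. \<lambda>i\<in>{..k}. D i \<omega>) \<in> measurable M (\<Pi>\<^sub>M i\<in>{..k}. borel)"
    using meas by (intro measurable_restrict) auto
  have "(\<integral>\<omega>. chain w \<phi> k (\<lambda>i. x + W (s + i * \<delta>) \<omega>) \<partial>M)
      = (\<integral>\<omega>. chain w \<phi> k (\<lambda>i. x + (\<Sum>j\<le>i. (\<lambda>i\<in>{..k}. D i \<omega>) j)) \<partial>M)"
    using AE s by (intro integral_cong_AE measurable_chain measurable_compose[OF m2 m] borel_measurable_add mW) auto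
  also have "\<dots> = (\<integral>d. chain w \<phi> k (\<lambda>i. x + (\<Sum>j\<le>i. d j)) \<partial>PiM {..k} (\<lambda>i. gauss (v i)))"
    unfolding joint[symmetric] by (rule integral_distr[OF m2 m, symmetric])
  also have "\<dots> = heat s \<phi> x"
    unfolding v(3)[symmetric] by (rule chain_integral_PiM) (use v K harm in auto)
  finally show ?thesis .
qed

lemma indep_rv_distr:
  assumes "indep_rv N X N' Y"
  shows "distr M (N \<Otimes>\<^sub>M N') (\<lambda>\<omega>. (X \<omega>, Y \<omega>)) = distr M N X \<Otimes>\<^sub>M distr M N' Y"
proof -
  have [measurable]: "X \<in> measurable M N" "Y \<in> measurable M N'"
    and ind: "indep_set (sigma_sets (space M) {X -` A \<inter> space M | A. A \<in> sets N})
              (sigma_sets (space M) {Y -` A \<inter> space M | A. A \<in> sets N'})"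
    using assms by (auto simp: indep_rv_def)
  interpret X: prob_space "distr M N X" by (rule prob_space_distr) simp
  interpret Y: prob_space "distr M N' Y" by (rule prob_space_distr) simp
  show ?thesis
  proof (rule pair_measure_eqI[symmetric])
    show "sigma_finite_measure (distr M N X)" "sigma_finite_measure (distr M N' Y)" ..
    show "sets (distr M N X \<Otimes>\<^sub>M distr M N' Y) = sets (distr M (N \<Otimes>\<^sub>M N') (\<lambda>\<omega>. (X \<omega>, Y \<omega>)))"
      by (simp cong: sets_pair_measure_cong)
    fix A B assume "A \<in> sets (distr M N X)" "B \<in> sets (distr M N' Y)"
    then have [measurable]: "A \<in> sets N" "B \<in> sets N'" by auto
    have "prob ((X -` A \<inter> space M) \<inter> (Y -` B \<inter> space M)) = prob (X -` A \<inter> space M) * prob (Y -` B \<inter> space M)"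
      by (rule indep_setD[OF ind]) (auto intro!: sigma_sets.Basic)
    moreover have "(X -` A \<inter> space M) \<inter> (Y -` B \<inter> space M) = (\<lambda>\<omega>. (X \<omega>, Y \<omega>)) -` (A \<times> B) \<inter> space M"
      by auto
    ultimately show "emeasure (distr M N X) A * emeasure (distr M N' Y) B
        = emeasure (distr M (N \<Otimes>\<^sub>M N') (\<lambda>\<omega>. (X \<omega>, Y \<omega>))) (A \<times> B)"
      by (simp add: emeasure_distr emeasure_eq_measure ennreal_mult)
  qed
qed

text \<open>
  Fubini's theorem for independent random elements, with the outer integral kept over \<open>M\<close> so that it can
  be applied repeatedly without naming the laws.
\<close>
lemma indep_rv_expectation:
  fixes F :: "'b \<Rightarrow> 'c \<Rightarrow> 'd::{banach, second_countable_topology}"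
  assumes ind: "indep_rv N X N' Y"
    and F [measurable]: "case_prod F \<in> borel_measurable (N \<Otimes>\<^sub>M N')" and C: "\<And>x y. norm (F x y) \<le> C"
  shows "(\<integral>\<omega>. F (X \<omega>) (Y \<omega>) \<partial>M) = (\<integral>\<omega>. (\<integral>\<omega>'. F (X \<omega>) (Y \<omega>') \<partial>M) \<partial>M)"
proof -
  have [measurable]: "X \<in> measurable M N" "Y \<in> measurable M N'"
    using ind by (auto simp: indep_rv_def)
  interpret X: prob_space "distr M N X" by (rule prob_space_distr) simp
  interpret Y: prob_space "distr M N' Y" by (rule prob_space_distr) simp
  interpret XY: pair_prob_space "distr M N X" "distr M N' Y" ..
  have int: "integrable (distr M N X \<Otimes>\<^sub>M distr M N' Y) (case_prod F)"
    using C by (intro XY.P.integrable_bounded[where C = C]) auto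
  have "(\<integral>\<omega>. F (X \<omega>) (Y \<omega>) \<partial>M) = integral\<^sup>L (distr M (N \<Otimes>\<^sub>M N') (\<lambda>\<omega>. (X \<omega>, Y \<omega>))) (case_prod F)"
    by (subst integral_distr) auto
  also have "\<dots> = (\<integral>x. (\<integral>y. F x y \<partial>distr M N' Y) \<partial>distr M N X)"
    unfolding indep_rv_distr[OF ind] using XY.integral_fst'[OF int] by simp
  also have "\<dots> = (\<integral>\<omega>. (\<integral>y. F (X \<omega>) y \<partial>distr M N' Y) \<partial>M)"
    by (subst integral_distr) auto
  also have "\<dots> = (\<integral>\<omega>. (\<integral>\<omega>'. F (X \<omega>) (Y \<omega>') \<partial>M) \<partial>M)"
  proof (rule Bochner_Integration.integral_cong[OF refl])
    fix \<omega> assume "\<omega> \<in> space M"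
    then have "X \<omega> \<in> space N" by (rule measurable_space[rotated]) simp
    then show "(\<integral>y. F (X \<omega>) y \<partial>distr M N' Y) = (\<integral>\<omega>'. F (X \<omega>) (Y \<omega>') \<partial>M)"
      by (intro integral_distr) auto
  qed
  finally show ?thesis .
qed

text \<open>
  Conditionally on the position at time \<open>0\<close>, past and future are independent, and each of them contributes a martingale mean.
\<close>
lemma two_sided_chain_expectation:
  assumes B: "two_sided_brownian_motion B" and s: "0 < r" "0 < s" "0 < \<delta>"
    and [measurable]: "w \<in> borel_measurable borel" "\<phi> \<in> borel_measurable borel"
    and K: "\<And>x. norm (w x) \<le> K" "\<And>x. norm (\<phi> x) \<le> 1"
    and harm: "\<And>x. w x * heat \<delta> \<phi> x = \<phi> x"
  shows "(\<integral>\<omega>. chain w \<phi> j (\<lambda>i. B (- (r + i * \<delta>)) \<omega>) * chain w \<phi> l (\<lambda>i. B (s + i * \<delta>) \<omega>) \<partial>M)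
    = (\<integral>\<omega>. heat r \<phi> (B 0 \<omega>) * heat s \<phi> (B 0 \<omega>) \<partial>M)"
proof -
  define W where "W t \<omega> = B t \<omega> - B 0 \<omega>" for t \<omega>
  have ind0: "indep_rv borel (B 0) (PiM UNIV (\<lambda>_. borel)) (\<lambda>\<omega> t. W t \<omega>)"
    and W: "two_sided_standard_brownian_motion W"
    using B unfolding two_sided_brownian_motion_def W_def [abs_def] by auto
  have bm: "standard_brownian_motion W" "standard_brownian_motion (\<lambda>t. W (- t))"
    and ind1: "indep_rv (PiM {0..} (\<lambda>_. borel)) (\<lambda>\<omega>. \<lambda>t\<in>{0..}. W t \<omega>)
             (PiM {0..} (\<lambda>_. borel)) (\<lambda>\<omega>. \<lambda>t\<in>{0..}. W (- t) \<omega>)"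
    using W unfolding two_sided_standard_brownian_motion_def by auto
  have "0 \<le> K" using K(1)[of 0] norm_ge_zero[of "w 0"] by linarith
  then have C: "norm (chain w \<phi> j y * chain w \<phi> l z) \<le> K ^ j * K ^ l" for y z
    unfolding norm_mult using norm_chain_le[OF K] by (intro mult_mono) auto
  \<comment> \<open>the functional of starting point and increment process to which both independence assumptions are applied in turn\<close>
  define F where "F x v = chain w \<phi> j (\<lambda>i. x + v (- (r + i * \<delta>))) * chain w \<phi> l (\<lambda>i. x + v (s + i * \<delta>))"
    for x and v :: "real \<Rightarrow> real"
  have split: "(\<integral>\<omega>. F x (\<lambda>t. W t \<omega>) \<partial>M) = heat r \<phi> x * heat s \<phi> x" for x
  proof -
    define G where "G v u = chain w \<phi> j (\<lambda>i. x + u (r + i * \<delta>)) * chain w \<phi> l (\<lambda>i. x + v (s + i * \<delta>))"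
      for u v :: "real \<Rightarrow> real"
    have "(\<integral>\<omega>. F x (\<lambda>t. W t \<omega>) \<partial>M) = (\<integral>\<omega>. G (\<lambda>t\<in>{0..}. W t \<omega>) (\<lambda>t\<in>{0..}. W (- t) \<omega>) \<partial>M)"
      using s by (simp add: F_def G_def)
    also have "\<dots> = (\<integral>\<omega>. (\<integral>\<omega>'. G (\<lambda>t\<in>{0..}. W t \<omega>) (\<lambda>t\<in>{0..}. W (- t) \<omega>') \<partial>M) \<partial>M)"
    proof (rule indep_rv_expectation[OF ind1, where C = "K ^ j * K ^ l"])
      have "(\<lambda>p. chain w \<phi> j (\<lambda>i. x + snd p (r + i * \<delta>)) * chain w \<phi> l (\<lambda>i. x + fst p (s + i * \<delta>)))
          \<in> borel_measurable (PiM {0..} (\<lambda>_. borel) \<Otimes>\<^sub>M PiM {0..} (\<lambda>_. borel))"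
        using s by (intro borel_measurable_times measurable_chain borel_measurable_add borel_measurable_const
            measurable_compose[OF measurable_fst measurable_component_singleton]
            measurable_compose[OF measurable_snd measurable_component_singleton]) auto
      then show "case_prod G \<in> borel_measurable (PiM {0..} (\<lambda>_. borel) \<Otimes>\<^sub>M PiM {0..} (\<lambda>_. borel))"
        by (simp add: G_def case_prod_unfold)
    qed (simp add: G_def C)
    also have "\<dots> = (\<integral>\<omega>. (\<integral>\<omega>'. chain w \<phi> j (\<lambda>i. x + W (- (r + i * \<delta>)) \<omega>') * chain w \<phi> l (\<lambda>i. x + W (s + i * \<delta>) \<omega>) \<partial>M) \<partial>M)"
      using s by (simp add: G_def)
    also have "\<dots> = (\<integral>\<omega>. heat r \<phi> x * chain w \<phi> l (\<lambda>i. x + W (s + i * \<delta>) \<omega>) \<partial>M)"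
      using brownian_chain_expectation[OF bm(2) s(1,3) assms(5,6) K harm, of j x] by simp
    also have "\<dots> = heat r \<phi> x * heat s \<phi> x"
      using brownian_chain_expectation[OF bm(1) s(2,3) assms(5,6) K harm, of l x] by simp
    finally show ?thesis .
  qed
  have "(\<integral>\<omega>. chain w \<phi> j (\<lambda>i. B (- (r + i * \<delta>)) \<omega>) * chain w \<phi> l (\<lambda>i. B (s + i * \<delta>) \<omega>) \<partial>M)
      = (\<integral>\<omega>. F (B 0 \<omega>) (\<lambda>t. W t \<omega>) \<partial>M)"
    by (simp add: F_def W_def)
  also have "\<dots> = (\<integral>\<omega>. (\<integral>\<omega>'. F (B 0 \<omega>) (\<lambda>t. W t \<omega>') \<partial>M) \<partial>M)"
  proof (rule indep_rv_expectation[OF ind0, where C = "K ^ j * K ^ l"])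
    have "(\<lambda>p. chain w \<phi> j (\<lambda>i. fst p + snd p (- (r + i * \<delta>))) * chain w \<phi> l (\<lambda>i. fst p + snd p (s + i * \<delta>)))
        \<in> borel_measurable (borel \<Otimes>\<^sub>M PiM UNIV (\<lambda>_. borel))"
      by (intro borel_measurable_times measurable_chain borel_measurable_add measurable_fst
          measurable_compose[OF measurable_snd measurable_component_singleton]) auto
    then show "case_prod F \<in> borel_measurable (borel \<Otimes>\<^sub>M PiM UNIV (\<lambda>_. borel))"
      by (simp add: F_def case_prod_unfold)
  qed (simp add: F_def C)
  finally show ?thesis
    by (simp add: split)
qed

end

section \<open>Time averages seen from a non-negative shift\<close>

text \<open>
  Joint measurability, needed for exchanging time averages and expectations, holds because a continuous path is the limit of
  its values on the grids of mesh \<open>1 / Suc n\<close>.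
\<close>
lemma measurable_continuous_paths:
  fixes Y :: "real \<Rightarrow> 'a \<Rightarrow> real"
  assumes meas: "\<And>t. Y t \<in> borel_measurable M" and cont: "\<And>\<omega>. continuous_on UNIV (\<lambda>t. Y t \<omega>)"
  shows "(\<lambda>p. Y (fst p) (snd p)) \<in> borel_measurable (borel \<Otimes>\<^sub>M M)"
proof (rule borel_measurable_LIMSEQ_real)
  \<comment> \<open>sampling at the grid point to the left reduces measurability to countably many fixed times\<close>
  define g where "g n t = real_of_int \<lfloor>real (Suc n) * t\<rfloor> / real (Suc n)" for n t
  show "(\<lambda>p. Y (g n (fst p)) (snd p)) \<in> borel_measurable (borel \<Otimes>\<^sub>M M)" for n
  proof -
    have "(\<lambda>p. Y (real_of_int k / real (Suc n)) (snd p)) \<in> borel_measurable (borel \<Otimes>\<^sub>M M)" for k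
      by (rule measurable_compose[OF measurable_snd meas])
    moreover have "(\<lambda>p. \<lfloor>real (Suc n) * fst p\<rfloor>) \<in> measurable (borel \<Otimes>\<^sub>M M) (count_space UNIV)"
      by measurable
    ultimately show ?thesis
      unfolding g_def by (rule measurable_compose_countable)
  qed
  fix p :: "real \<times> 'a"
  have "(\<lambda>n. g n t) \<longlonglongrightarrow> t" for t
  proof (rule tendsto_sandwich)
    show "\<forall>\<^sub>F n in sequentially. t - inverse (real (Suc n)) \<le> g n t"
    proof (rule always_eventually, rule allI)
      fix n
      have "real (Suc n) * t - 1 \<le> real_of_int \<lfloor>real (Suc n) * t\<rfloor>" by linarith
      then have "(real (Suc n) * t - 1) / real (Suc n) \<le> g n t"
        unfolding g_def by (rule divide_right_mono) simp
      then show "t - inverse (real (Suc n)) \<le> g n t"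
        by (simp add: diff_divide_distrib inverse_eq_divide del: of_nat_Suc)
    qed
    show "\<forall>\<^sub>F n in sequentially. g n t \<le> t"
    proof (rule always_eventually, rule allI)
      fix n
      have "real_of_int \<lfloor>real (Suc n) * t\<rfloor> \<le> real (Suc n) * t" by linarith
      then show "g n t \<le> t"
        unfolding g_def by (simp add: field_simps del: of_nat_Suc)
    qed
    show "(\<lambda>n. t - inverse (real (Suc n))) \<longlonglongrightarrow> t"
      using tendsto_diff[OF tendsto_const LIMSEQ_inverse_real_of_nat, of t] by simp
  qed simp
  moreover have "isCont (\<lambda>t. Y t (snd p)) (fst p)"
    using cont[of "snd p"] by (simp add: continuous_on_eq_continuous_at)
  ultimately show "(\<lambda>n. Y (g n (fst p)) (snd p)) \<longlonglongrightarrow> Y (fst p) (snd p)"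
    by (rule isCont_tendsto_compose[rotated])
qed

lemma emeasure_Icc_finite: "emeasure lborel {a..b :: real} < \<top>"
  using emeasure_bounded_finite[OF bounded_closed_interval, of a b] by simp

context prob_space
begin

lemma two_sided_brownian_motion_measurable:
  assumes "two_sided_brownian_motion B"
  shows "B t \<in> borel_measurable M"
proof -
  define W where "W t \<omega> = B t \<omega> - B 0 \<omega>" for t \<omega>
  have B0: "B 0 \<in> borel_measurable M"
    using assms by (auto simp: two_sided_brownian_motion_def indep_rv_def)
  have "two_sided_standard_brownian_motion W"
    using assms unfolding two_sided_brownian_motion_def W_def [abs_def] by auto
  then have "\<forall>t\<ge>0. W t \<in> borel_measurable M" "\<forall>t\<ge>0. W (- t) \<in> borel_measurable M"
    unfolding two_sided_standard_brownian_motion_def standard_brownian_motion_def by blast+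
  then have "W t \<in> borel_measurable M"
    by (cases "0 \<le> t") (auto dest: spec[of _ "- t"])
  with B0 have "(\<lambda>\<omega>. W t \<omega> + B 0 \<omega>) \<in> borel_measurable M"
    by (intro borel_measurable_add)
  then show ?thesis by (simp add: W_def)
qed

lemma two_sided_brownian_motion_continuous_version:
  assumes B: "two_sided_brownian_motion B"
  obtains B' where "\<And>t. B' t \<in> borel_measurable M" "\<And>\<omega>. continuous_on UNIV (\<lambda>t. B' t \<omega>)"
    "AE \<omega> in M. \<forall>t. B' t \<omega> = B t \<omega>"
proof -
  have "AE \<omega> in M. continuous_on {0..} (\<lambda>t. B t \<omega> - B 0 \<omega>)"
    and "AE \<omega> in M. continuous_on {0..} (\<lambda>t. B (- t) \<omega> - B 0 \<omega>)"
    using B unfolding two_sided_brownian_motion_def two_sided_standard_brownian_motion_def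
      standard_brownian_motion_def by auto
  then have "AE \<omega> in M. continuous_on UNIV (\<lambda>t. B t \<omega>)"
  proof eventually_elim
    case (elim \<omega>)
    have 1: "continuous_on {0..} (\<lambda>t. B t \<omega>)"
      using continuous_on_add[OF elim(1) continuous_on_const[of _ "B 0 \<omega>"]] by simp
    have "continuous_on {..0} (\<lambda>t. B (- (- t)) \<omega> - B 0 \<omega>)"
      by (rule continuous_on_compose2[OF elim(2), of _ uminus]) (auto intro!: continuous_intros)
    then have 2: "continuous_on {..0} (\<lambda>t. B t \<omega>)"
      using continuous_on_add[OF _ continuous_on_const[of _ "B 0 \<omega>"]] by fastforce
    have "{0..} \<union> {..0} = (UNIV :: real set)" by auto
    then show ?case
      using continuous_on_closed_Un[OF _ _ 1 2] by simp
  qed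
  then obtain N where N: "{\<omega>\<in>space M. \<not> continuous_on UNIV (\<lambda>t. B t \<omega>)} \<subseteq> N" "N \<in> null_sets M"
    by (auto elim!: AE_E simp: null_sets_def)
  define B' where "B' t \<omega> = (if \<omega> \<in> space M - N then B t \<omega> else 0)" for t \<omega>
  show thesis
  proof (rule that)
    show "B' t \<in> borel_measurable M" for t
      unfolding B'_def [abs_def] using N two_sided_brownian_motion_measurable[OF B]
      by (intro measurable_If_set) auto
    show "continuous_on UNIV (\<lambda>t. B' t \<omega>)" for \<omega>
      using N by (cases "\<omega> \<in> space M - N") (auto simp: B'_def)
    show "AE \<omega> in M. \<forall>t. B' t \<omega> = B t \<omega>"
      using AE_not_in[OF N(2)] AE_space by eventually_elim (auto simp: B'_def)
  qed
qed

text \<open>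
  For each \<open>\<omega>\<close> the integrals of \<open>\<psi>\<close> over \<open>[-L, 0]\<close> and over \<open>[T - L, T]\<close> differ only on
  the symmetric difference of these intervals, two pieces of length \<open>min T L\<close>.
\<close>
lemma shift_comparison:
  fixes \<psi> :: "real \<Rightarrow> 'a \<Rightarrow> real" and T :: "'a \<Rightarrow> real"
  assumes \<psi>: "(\<lambda>p. \<psi> (fst p) (snd p)) \<in> borel_measurable (borel \<Otimes>\<^sub>M M)"
    and C: "\<And>u \<omega>. \<bar>\<psi> u \<omega>\<bar> \<le> C"
    and T [measurable]: "T \<in> borel_measurable M" and T0: "AE \<omega> in M. 0 \<le> T \<omega>"
    and L: "0 < L"
    and q: "AE u in lborel. u \<in> {-L..0} \<longrightarrow> q \<le> (\<integral>\<omega>. \<psi> u \<omega> \<partial>M) - (\<integral>\<omega>. \<psi> (T \<omega> + u) \<omega> \<partial>M)"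
  shows "q * L \<le> 2 * C * (\<integral>\<omega>. min (T \<omega>) L \<partial>M)"
proof -
  have "0 \<le> C" using C[of 0 undefined] by linarith
  note [measurable] = \<psi>
  have sh [measurable]: "(\<lambda>p. \<psi> (T (snd p) + fst p) (snd p)) \<in> borel_measurable (borel \<Otimes>\<^sub>M M)"
    using measurable_compose[OF _ \<psi>, of "\<lambda>p. (T (snd p) + fst p, snd p)" "borel \<Otimes>\<^sub>M M"] by simp
  interpret U: pair_sigma_finite lborel M ..
  define F where "F u \<omega> = indicator {-L..0} u * (\<psi> u \<omega> - \<psi> (T \<omega> + u) \<omega>)" for u \<omega>
  have path: "(\<lambda>u. \<psi> u \<omega>) \<in> borel_measurable borel" if "\<omega> \<in> space M" for \<omega>
    using measurable_compose[OF _ \<psi>, of "\<lambda>u. (u, \<omega>)" borel] that by simp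
  have mu: "(\<lambda>\<omega>. \<psi> u \<omega>) \<in> borel_measurable M" "(\<lambda>\<omega>. \<psi> (T \<omega> + u) \<omega>) \<in> borel_measurable M" for u
    using measurable_compose[OF _ \<psi>, of "\<lambda>\<omega>. (u, \<omega>)" M] measurable_compose[OF _ sh, of "\<lambda>\<omega>. (u, \<omega>)" M] by simp_all
  have int: "integrable (lborel \<Otimes>\<^sub>M M) (case_prod F)"
  proof (rule integrableI_bounded_set[where A = "{-L..0} \<times> space M" and B = "2 * C"])
    show "case_prod F \<in> borel_measurable (lborel \<Otimes>\<^sub>M M)"
      unfolding F_def case_prod_unfold by measurable
    show "emeasure (lborel \<Otimes>\<^sub>M M) ({- L..0} \<times> space M) < \<infinity>"
      using L by (subst emeasure_pair_measure_Times) (auto simp: emeasure_space_1)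
    have "\<bar>\<psi> u \<omega> - \<psi> (T \<omega> + u) \<omega>\<bar> \<le> 2 * C" for u \<omega>
      using C[of u \<omega>] C[of "T \<omega> + u" \<omega>] by linarith
    then show "AE x in lborel \<Otimes>\<^sub>M M. x \<in> {- L..0} \<times> space M \<longrightarrow> norm (case_prod F x) \<le> 2 * C"
      using \<open>0 \<le> C\<close> by (auto simp: F_def abs_mult indicator_def)
    show "AE x in lborel \<Otimes>\<^sub>M M. x \<notin> {- L..0} \<times> space M \<longrightarrow> case_prod F x = 0"
      using AE_space by eventually_elim (auto simp: F_def space_pair_measure indicator_def)
  qed simp_all
  have bound: "(\<integral>u. F u \<omega> \<partial>lborel) \<le> 2 * C * min (T \<omega>) L" if \<omega>: "\<omega> \<in> space M" "0 \<le> T \<omega>" for \<omega>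
  proof -
    have [measurable]: "(\<lambda>u. \<psi> u \<omega>) \<in> borel_measurable borel" by (rule path) fact
    define t where "t = T \<omega>"
    have i: "integrable lborel (\<lambda>u. indicator {a..b} u * \<psi> (c + u) \<omega>)" for a b c :: real
      using C emeasure_Icc_finite[of a b]
      by (intro integrableI_bounded_set[where A = "{a..b}" and B = C]) (auto simp: indicator_def)
    have i2: "integrable lborel (\<lambda>u. indicator {a..b} u :: real)" for a b :: real
      using emeasure_Icc_finite[of a b] by (intro integrable_real_indicator) auto
    have "(\<integral>u. F u \<omega> \<partial>lborel) = (\<integral>u. indicator {-L..0} u * \<psi> u \<omega> \<partial>lborel)
        - (\<integral>u. indicator {-L..0} u * \<psi> (t + u) \<omega> \<partial>lborel)"
      unfolding F_def t_def[symmetric] right_diff_distrib using i[of _ _ 0] i[of _ _ t]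
      by (intro Bochner_Integration.integral_diff) auto
    also have "(\<integral>u. indicator {-L..0} u * \<psi> (t + u) \<omega> \<partial>lborel)
        = (\<integral>u. indicator {t-L..t} (t + u) * \<psi> (t + u) \<omega> \<partial>lborel)"
      by (intro Bochner_Integration.integral_cong) (auto simp: indicator_def)
    also have "\<dots> = (\<integral>u. indicator {t-L..t} u * \<psi> u \<omega> \<partial>lborel)"
      using lborel_integral_real_affine[of 1 "\<lambda>u. indicator {t-L..t} u * \<psi> u \<omega>" t] by simp
    also have "(\<integral>u. indicator {-L..0} u * \<psi> u \<omega> \<partial>lborel) - \<dots>
        = (\<integral>u. indicator {-L..0} u * \<psi> u \<omega> - indicator {t-L..t} u * \<psi> u \<omega> \<partial>lborel)"
      using i[of _ _ 0] by (intro Bochner_Integration.integral_diff[symmetric]) auto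
    also have "\<dots> \<le> (\<integral>u. C * (indicator {-L..min 0 (t-L)} u + indicator {max 0 (t-L)..t} u) \<partial>lborel)"
    proof (rule integral_mono)
      show "integrable lborel (\<lambda>u. indicator {-L..0} u * \<psi> u \<omega> - indicator {t-L..t} u * \<psi> u \<omega>)"
        using i[of _ _ 0] by (intro Bochner_Integration.integrable_diff) auto
      show "integrable lborel (\<lambda>u. C * (indicator {-L..min 0 (t-L)} u + indicator {max 0 (t-L)..t} u))"
        by (intro integrable_mult_right Bochner_Integration.integrable_add i2)
      show "indicator {-L..0} u * \<psi> u \<omega> - indicator {t-L..t} u * \<psi> u \<omega>
          \<le> C * (indicator {-L..min 0 (t-L)} u + indicator {max 0 (t-L)..t} u)" for u
        using C[of u \<omega>] \<open>0 \<le> C\<close> \<omega>(2) by (auto simp: indicator_def t_def abs_le_iff)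
    qed
    also have "\<dots> = C * ((min 0 (t-L) + L) + (t - max 0 (t-L)))"
      using \<omega>(2) L i2 by (subst Bochner_Integration.integral_mult_right) (auto simp: t_def)
    also have "\<dots> = 2 * C * min (T \<omega>) L"
      by (auto simp: t_def min_def max_def algebra_simps)
    finally show ?thesis .
  qed
  have "q * L = (\<integral>u. indicator {-L..0} u * q \<partial>lborel)"
    using L by (simp add: mult.commute)
  also have "\<dots> \<le> (\<integral>u. (\<integral>\<omega>. F u \<omega> \<partial>M) \<partial>lborel)"
  proof (rule integral_mono_AE)
    show "integrable lborel (\<lambda>u. indicator {-L..0} u * q)"
      using emeasure_Icc_finite by (intro integrable_mult_left integrable_real_indicator) auto
    show "integrable lborel (\<lambda>u. \<integral>\<omega>. F u \<omega> \<partial>M)"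
      using U.integrable_fst[OF int] by simp
    have "(\<integral>\<omega>. F u \<omega> \<partial>M) = indicator {-L..0} u * ((\<integral>\<omega>. \<psi> u \<omega> \<partial>M) - (\<integral>\<omega>. \<psi> (T \<omega> + u) \<omega> \<partial>M))" for u
      unfolding F_def using mu C
      by (subst Bochner_Integration.integral_mult_right_zero, subst Bochner_Integration.integral_diff)
        (auto intro!: integrable_bounded[where C = C])
    note F_eq = this
    from q show "AE u in lborel. indicator {-L..0} u * q \<le> (\<integral>\<omega>. F u \<omega> \<partial>M)"
      by eventually_elim (auto simp: F_eq indicator_def)
  qed
  also have "\<dots> = (\<integral>\<omega>. (\<integral>u. F u \<omega> \<partial>lborel) \<partial>M)"
    using U.Fubini_integral[OF int] by simp
  also have "\<dots> \<le> (\<integral>\<omega>. 2 * C * min (T \<omega>) L \<partial>M)"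
  proof (rule integral_mono_AE)
    show "integrable M (\<lambda>\<omega>. \<integral>u. F u \<omega> \<partial>lborel)"
      using U.integrable_snd[OF int] by simp
    have "integrable M (\<lambda>\<omega>. min (T \<omega>) L)"
      using T0 L by (intro integrable_const_bound[where B = L]) auto
    then show "integrable M (\<lambda>\<omega>. 2 * C * min (T \<omega>) L)" by simp
    show "AE \<omega> in M. (\<integral>u. F u \<omega> \<partial>lborel) \<le> 2 * C * min (T \<omega>) L"
      using T0 AE_space by eventually_elim (rule bound)
  qed
  also have "\<dots> = 2 * C * (\<integral>\<omega>. min (T \<omega>) L \<partial>M)" by simp
  finally show ?thesis .
qed

end

section \<open>A Lipschitz function separating singular laws\<close>

text \<open>
  Singularity and inner regularity give a compact set of \<open>\<mu>\<close>-measure above \<open>3/4\<close> that is null for \<open>\<nu>\<close>.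
  Steep tent functions around it decrease to its indicator. Integrability over the line makes the potential of \<open>f\<close> finite,
  and the Lipschitz bound controls the effect of a short averaging time.
\<close>
lemma separating_Lipschitz_function:
  fixes \<mu> \<nu> :: "real measure"
  assumes "real_distribution \<mu>" "real_distribution \<nu>" and sing: "mutually_singular \<mu> \<nu>"
  obtains f :: "real \<Rightarrow> real" and L where "integrable lborel f" "\<And>x. 0 \<le> f x" "\<And>x. f x \<le> 1"
    "\<And>x y. \<bar>f x - f y\<bar> \<le> L * \<bar>x - y\<bar>" "(\<integral>x. f x \<partial>\<nu>) + 1 / 4 \<le> (\<integral>x. f x \<partial>\<mu>)"
proof -
  interpret \<mu>: real_distribution \<mu> by fact
  interpret \<nu>: real_distribution \<nu> by fact
  obtain A where A: "A \<in> sets borel" "emeasure \<mu> A = 0" "emeasure \<nu> (UNIV - A) = 0"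
    using sing by (auto simp: mutually_singular_def)
  have "emeasure \<mu> (UNIV - A) = 1"
    using A \<mu>.emeasure_space_1 emeasure_Diff[of \<mu> A UNIV] by simp
  then have "(SUP K\<in>{K. K \<subseteq> UNIV - A \<and> compact K}. emeasure \<mu> K) = 1"
    using inner_regular[of \<mu> "UNIV - A"] A(1) by simp
  moreover have "ennreal (3 / 4) < 1"
    by (simp add: ennreal_less_one_iff)
  ultimately have "ennreal (3 / 4) < (SUP K\<in>{K. K \<subseteq> UNIV - A \<and> compact K}. emeasure \<mu> K)"
    by simp
  then obtain K where K: "K \<subseteq> UNIV - A" "compact K" "ennreal (3 / 4) < emeasure \<mu> K"
    unfolding less_SUP_iff by auto
  have Kb [measurable]: "K \<in> sets borel"
    using K(2) by (intro borel_closed compact_imp_closed)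
  have \<mu>K: "3 / 4 \<le> measure \<mu> K"
    using K(3) by (simp add: \<mu>.emeasure_eq_measure ennreal_less_iff)
  have "emeasure \<nu> K \<le> emeasure \<nu> (UNIV - A)"
    using A(1) K(1) by (intro emeasure_mono) auto
  then have \<nu>K: "measure \<nu> K = 0"
    using A(3) by (simp add: measure_def)
  have "K \<noteq> {}" using \<mu>K by auto
  have "bounded K" using K(2) by (rule compact_imp_bounded)
  then obtain a where a: "\<And>x. x \<in> K \<Longrightarrow> \<bar>x\<bar> \<le> a"
    by (auto simp: bounded_iff)
  define f where "f n x = max 0 (1 - real n * infdist x K)" for n x
  have f01: "0 \<le> f n x" "f n x \<le> 1" for n x
    by (auto simp: f_def infdist_nonneg)
  have lip: "\<bar>f n x - f n y\<bar> \<le> real n * \<bar>x - y\<bar>" for n x y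
  proof -
    have "\<bar>f n x - f n y\<bar> \<le> \<bar>real n * infdist x K - real n * infdist y K\<bar>"
      unfolding f_def by linarith
    also have "\<dots> = real n * \<bar>infdist x K - infdist y K\<bar>"
      by (simp add: abs_mult right_diff_distrib[symmetric])
    also have "\<dots> \<le> real n * \<bar>x - y\<bar>"
      using infdist_triangle_abs[of x K y] by (intro mult_left_mono) (auto simp: dist_real_def)
    finally show ?thesis .
  qed
  have [measurable]: "f n \<in> borel_measurable borel" for n
    unfolding f_def [abs_def]
    by (intro borel_measurable_continuous_onI continuous_intros)
  have ge: "indicator K x \<le> f n x" for n x
    using f01 by (auto simp: indicator_def f_def)
  have lim: "(\<lambda>n. f n x) \<longlonglongrightarrow> indicator K x" for x
  proof (cases "x \<in> K")
    case False
    then have "0 < infdist x K"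
      using K(2) \<open>K \<noteq> {}\<close> by (intro infdist_pos_not_in_closed compact_imp_closed)
    then obtain N where N: "1 < real N * infdist x K"
      using reals_Archimedean3 by blast
    have "f n x = 0" if "N \<le> n" for n
    proof -
      have "real N * infdist x K \<le> real n * infdist x K"
        using that by (intro mult_right_mono infdist_nonneg) auto
      then show ?thesis using N by (simp add: f_def)
    qed
    then have "(\<lambda>n. f n x) \<longlonglongrightarrow> 0"
      by (intro tendsto_eventually eventually_sequentiallyI[of N])
    then show ?thesis using False by simp
  qed (simp add: f_def)
  have "(\<lambda>n. \<integral>x. f n x \<partial>\<nu>) \<longlonglongrightarrow> (\<integral>x. indicator K x \<partial>\<nu>)"
    using f01 lim by (intro integral_dominated_convergence[where w = "\<lambda>_. 1"]) auto
  then have "(\<lambda>n. \<integral>x. f n x \<partial>\<nu>) \<longlonglongrightarrow> 0"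
    using \<nu>K by simp
  then have "eventually (\<lambda>n. (\<integral>x. f n x \<partial>\<nu>) < 1 / 2 \<and> 1 \<le> n) sequentially"
    by (intro eventually_conj order_tendstoD eventually_ge_at_top) auto
  then obtain n where n: "(\<integral>x. f n x \<partial>\<nu>) < 1 / 2" "1 \<le> n"
    by (auto simp: eventually_sequentially)
  have "(\<integral>x. indicator K x \<partial>\<mu>) \<le> (\<integral>x. f n x \<partial>\<mu>)"
    using f01 ge by (intro integral_mono) (auto intro!: \<mu>.integrable_bounded[where C = 1])
  then have "(\<integral>x. f n x \<partial>\<nu>) + 1 / 4 \<le> (\<integral>x. f n x \<partial>\<mu>)"
    using \<mu>K n(1) by simp
  moreover have "integrable lborel (f n)"
  proof (rule integrableI_bounded_set[where A = "{- (a + 1)..a + 1}" and B = 1])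
    have "f n x = 0" if "x \<notin> {- (a + 1)..a + 1}" for x
    proof -
      obtain y where y: "y \<in> K" "infdist x K = dist x y"
        using infdist_attains_inf[OF compact_imp_closed[OF K(2)] \<open>K \<noteq> {}\<close>] .
      then have "1 \<le> infdist x K"
        using a[OF y(1)] that by (auto simp: dist_real_def)
      then have "1 * 1 \<le> real n * infdist x K"
        using n(2) by (intro mult_mono) auto
      then show ?thesis by (simp add: f_def)
    qed
    then show "AE x in lborel. x \<notin> {- (a + 1)..a + 1} \<longrightarrow> f n x = 0" by auto
    show "AE x in lborel. x \<in> {- (a + 1)..a + 1} \<longrightarrow> norm (f n x) \<le> 1"
      using f01 by simp
  qed (simp_all add: emeasure_Icc_finite del: minus_add_distrib)
  ultimately show thesis
    by (intro that[of "f n" "real n"] f01 lip)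
qed

section \<open>A phase with slowly varying amplitude\<close>

text \<open>
  The case \<open>k = 0\<close> is separate because \<open>gauss 0\<close> is not the point mass at \<open>0\<close>: the normal density with
  deviation \<open>0\<close> is the zero function.
\<close>
definition heat_iter :: "real \<Rightarrow> (real \<Rightarrow> real) \<Rightarrow> nat \<Rightarrow> real \<Rightarrow> real" where
  "heat_iter \<delta> f k = (if k = 0 then f else heat (k * \<delta>) f)"

lemma sum_inverse_sqrt_le: "(\<Sum>k<m. 1 / sqrt (Suc k)) \<le> 2 * sqrt m"
proof (induction m)
  case (Suc m)
  define a b where "a = sqrt m" and "b = sqrt (Suc m)"
  have ab: "0 < b" "b\<^sup>2 = a\<^sup>2 + 1"
    by (auto simp: a_def b_def)
  have "1 \<le> (b\<^sup>2 - a\<^sup>2) + (b - a)\<^sup>2"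
    unfolding ab(2) by simp
  also have "\<dots> = 2 * (b - a) * b"
    by (simp add: power2_eq_square algebra_simps)
  finally have "1 / b \<le> 2 * (b - a)"
    using ab(1) by (simp only: pos_divide_le_eq)
  then have "1 / sqrt (Suc m) \<le> 2 * sqrt (Suc m) - 2 * sqrt m"
    unfolding a_def b_def by (simp only: right_diff_distrib)
  then show ?case using Suc.IH by simp
qed simp

context
  fixes f :: "real \<Rightarrow> real" and \<delta> C0 :: real
  assumes f: "integrable lborel f" "\<And>x. 0 \<le> f x" "\<And>x. f x \<le> 1" and \<delta>: "0 < \<delta>"
    and C0: "C0 = 1 + 2 * ((\<integral>x. f x \<partial>lborel) / sqrt (2 * pi * \<delta>))"
begin

lemma integrable_imp_borel [measurable]: "f \<in> borel_measurable borel"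
  using f(1) by auto

lemma measurable_heat_iter [measurable]: "heat_iter \<delta> f k \<in> borel_measurable borel"
  unfolding heat_iter_def using \<delta> by auto

lemma heat_iter_nonneg: "0 \<le> heat_iter \<delta> f k x"
  using f by (auto simp: heat_iter_def heat_def intro!: Bochner_Integration.integral_nonneg)

lemma heat_iter_le_1: "heat_iter \<delta> f k x \<le> 1"
proof (cases "k = 0")
  case False
  then show ?thesis
    using norm_heat_le[of "k * \<delta>" f 1 x] \<delta> f by (auto simp: heat_iter_def)
qed (simp add: heat_iter_def f)

lemma abs_heat_iter_le_1: "\<bar>heat_iter \<delta> f k x\<bar> \<le> 1"
  using heat_iter_nonneg heat_iter_le_1 by simp

lemma heat_heat_iter: "heat \<delta> (heat_iter \<delta> f k) x = heat_iter \<delta> f (Suc k) x"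
proof (cases "k = 0")
  case False
  then have "heat \<delta> (heat (k * \<delta>) f) x = heat (\<delta> + k * \<delta>) f x"
    using \<delta> f by (intro heat_heat[where C = 1]) auto
  also have "\<delta> + k * \<delta> = Suc k * \<delta>" by (simp add: algebra_simps)
  finally show ?thesis using False by (simp add: heat_iter_def)
qed (simp add: heat_iter_def)

lemma decay_constant_ge_1: "1 \<le> C0"
  unfolding C0 using f \<delta> by (auto intro!: divide_nonneg_nonneg Bochner_Integration.integral_nonneg)

lemma heat_iter_decay: "heat_iter \<delta> f k x \<le> C0 / sqrt (Suc k)"
proof (cases "k = 0")
  case True
  then show ?thesis using f(3)[of x] decay_constant_ge_1 by (simp add: heat_iter_def)
next
  case False
  define D where "D = (\<integral>x. f x \<partial>lborel) / sqrt (2 * pi * \<delta>)"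
  have D: "0 \<le> D" unfolding D_def
    using f \<delta> by (auto intro!: divide_nonneg_nonneg Bochner_Integration.integral_nonneg)
  have k: "0 < real k" using False by simp
  have "heat_iter \<delta> f k x \<le> (\<integral>x. f x \<partial>lborel) / sqrt (2 * pi * (k * \<delta>))"
    using False \<delta> f by (simp add: heat_iter_def heat_le_kernel_bound)
  also have "sqrt (2 * pi * (k * \<delta>)) = sqrt (2 * pi * \<delta>) * sqrt k"
    by (simp add: real_sqrt_mult)
  also have "(\<integral>x. f x \<partial>lborel) / (sqrt (2 * pi * \<delta>) * sqrt k) = D / sqrt k"
    by (simp add: D_def)
  also have "\<dots> \<le> 2 * D / sqrt (Suc k)"
  proof -
    have "sqrt (Suc k) \<le> sqrt (4 * k)"
      using k False by (intro real_sqrt_le_mono) linarith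
    also have "\<dots> = 2 * sqrt k" by (simp add: real_sqrt_mult)
    finally have "D * sqrt (Suc k) \<le> D * (2 * sqrt k)"
      using D by (rule mult_left_mono)
    then show ?thesis
      using k by (simp add: field_simps)
  qed
  also have "\<dots> \<le> C0 / sqrt (Suc k)"
    unfolding C0 D_def by (rule divide_right_mono) auto
  finally show ?thesis .
qed

text \<open>
  The amplitude is \<open>c = 1 - (\<epsilon>\<^sup>2 / 2) * R\<close>, where \<open>R\<close> is the potential of \<open>f + P f\<close> truncated after \<open>m\<close> steps.
  Up to the terms of index \<open>m\<close>, averaging removes \<open>f + P f\<close> from \<open>R\<close>, so \<open>P c\<close> exceeds \<open>c\<close> by
  \<open>(\<epsilon>\<^sup>2 / 2) * (f + P f)\<close>. As \<open>R\<close> is of order \<open>sqrt m\<close> and the terms of index \<open>m\<close> are of order \<open>1 / sqrt m\<close>,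
  the choice \<open>\<epsilon>\<^sup>2 = \<theta>\<^sup>2 / sqrt m\<close> keeps \<open>c\<close> near \<open>1\<close> and makes the error of order \<open>1 / m\<close>.
\<close>
lemma exists_damping:
  assumes \<theta>: "3 * C0 * \<theta>\<^sup>2 \<le> 1" and m: "0 < m" and \<epsilon>: "\<epsilon>\<^sup>2 = \<theta>\<^sup>2 / sqrt (real m)"
  obtains c where "c \<in> borel_measurable borel" "\<And>x. 1 - 2 * C0 * \<theta>\<^sup>2 \<le> c x" "\<And>x. c x \<le> 1"
    "\<And>x. (1 - 1 / m) * c x \<le> heat \<delta> c x - \<epsilon>\<^sup>2 / 2 * (heat \<delta> f x + f x)"
proof -
  let ?F = "heat_iter \<delta> f"
  define \<kappa> where "\<kappa> = \<epsilon>\<^sup>2 / 2"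
  define R where "R n x = (\<Sum>k<n. ?F k x + ?F (Suc k) x)" for n x
  have [measurable]: "R n \<in> borel_measurable borel" for n
    unfolding R_def [abs_def] by measurable
  have R0: "0 \<le> R n x" for n x
    unfolding R_def by (intro sum_nonneg add_nonneg_nonneg heat_iter_nonneg)
  have decay: "?F k x + ?F (Suc k) x \<le> 2 * C0 * (1 / sqrt (Suc k))" for k x
  proof -
    have "C0 / sqrt (Suc (Suc k)) \<le> C0 / sqrt (Suc k)"
      using decay_constant_ge_1 by (intro divide_left_mono) auto
    then show ?thesis
      using heat_iter_decay[of k x] heat_iter_decay[of "Suc k" x] by simp
  qed
  have Rle: "R n x \<le> 4 * C0 * sqrt n" for n x
  proof -
    have "R n x \<le> (\<Sum>k<n. 2 * C0 * (1 / sqrt (Suc k)))"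
      unfolding R_def by (intro sum_mono decay)
    also have "\<dots> = 2 * C0 * (\<Sum>k<n. 1 / sqrt (Suc k))"
      by (simp add: sum_distrib_left)
    also have "\<dots> \<le> 2 * C0 * (2 * sqrt n)"
      using decay_constant_ge_1 by (intro mult_left_mono sum_inverse_sqrt_le) auto
    finally show ?thesis by simp
  qed
  have Rabs: "\<bar>R n x\<bar> \<le> 4 * C0 * sqrt n" for n x
    using R0 Rle by simp
  have two: "heat \<delta> (\<lambda>x. ?F k x + ?F (Suc k) x) x = ?F (Suc k) x + ?F (Suc (Suc k)) x" for k x
    using \<delta> abs_heat_iter_le_1 by (subst heat_add) (auto simp: heat_heat_iter)
  have PR: "heat \<delta> (R n) x = R n x - (f x + heat \<delta> f x) + (?F n x + ?F (Suc n) x)" for n x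
  proof (induction n)
    case 0
    then show ?case using \<delta> by (simp add: R_def heat_const heat_iter_def)
  next
    case (Suc n)
    have "heat \<delta> (R (Suc n)) x = heat \<delta> (\<lambda>x. R n x + (?F n x + ?F (Suc n) x)) x"
      by (simp add: R_def [abs_def])
    also have "\<dots> = heat \<delta> (R n) x + (?F (Suc n) x + ?F (Suc (Suc n)) x)"
      unfolding two[symmetric]
    proof (rule heat_add)
      show "\<bar>R n x\<bar> \<le> 4 * C0 * sqrt n" for x by (rule Rabs)
      show "\<bar>?F n x + ?F (Suc n) x\<bar> \<le> 2" for x
        using abs_heat_iter_le_1[of n x] abs_heat_iter_le_1[of "Suc n" x] by linarith
    qed (use \<delta> in measurable)
    finally have "heat \<delta> (R (Suc n)) x = heat \<delta> (R n) x + (?F (Suc n) x + ?F (Suc (Suc n)) x)" .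
    moreover have "R (Suc n) x = R n x + (?F n x + ?F (Suc n) x)"
      by (simp add: R_def)
    ultimately show ?case using Suc by linarith
  qed
  define c where "c x = 1 - \<kappa> * R m x" for x
  have \<kappa>: "0 \<le> \<kappa>" "\<kappa> = \<theta>\<^sup>2 / (2 * sqrt m)"
    by (auto simp: \<kappa>_def \<epsilon>)
  have \<kappa>R: "\<kappa> * R m x \<le> 2 * C0 * \<theta>\<^sup>2" for x
  proof -
    have "\<kappa> * R m x \<le> \<kappa> * (4 * C0 * sqrt m)"
      using Rle \<kappa>(1) by (intro mult_left_mono)
    also have "\<dots> = 2 * C0 * \<theta>\<^sup>2"
      using m by (simp add: \<kappa>(2))
    finally show ?thesis .
  qed
  have Pc: "heat \<delta> c x = 1 - \<kappa> * heat \<delta> (R m) x" for x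
  proof -
    have "heat \<delta> c x = heat \<delta> (\<lambda>x. 1 + (- \<kappa>) * R m x) x"
      by (simp add: c_def [abs_def])
    also have "\<dots> = heat \<delta> (\<lambda>x. 1) x + heat \<delta> (\<lambda>x. (- \<kappa>) * R m x) x"
    proof (rule heat_add)
      show "\<bar>(- \<kappa>) * R m x\<bar> \<le> 2 * C0 * \<theta>\<^sup>2" for x
        using \<kappa>R[of x] \<kappa>(1) R0[of m x] by (simp add: abs_mult)
    qed (use \<delta> in \<open>auto intro: order_refl\<close>)
    finally show ?thesis
      using \<delta> by (simp only: heat_cmult heat_const)
  qed
  show thesis
  proof (rule that)
    show "c \<in> borel_measurable borel"
      unfolding c_def [abs_def] by measurable
    show "1 - 2 * C0 * \<theta>\<^sup>2 \<le> c x" for x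
      using \<kappa>R by (simp add: c_def)
    show "c x \<le> 1" for x
      using \<kappa>(1) R0 by (simp add: c_def)
    fix x
    have "\<kappa> * (?F m x + ?F (Suc m) x) \<le> \<kappa> * (2 * C0 * (1 / sqrt (Suc m)))"
      using \<kappa>(1) decay by (rule mult_left_mono[rotated])
    also have "\<dots> \<le> \<kappa> * (2 * C0 * (1 / sqrt m))"
      using \<kappa>(1) decay_constant_ge_1 m by (intro mult_left_mono) (auto intro!: divide_left_mono)
    also have "\<dots> = C0 * \<theta>\<^sup>2 / m"
      using m by (simp add: \<kappa>(2) field_simps)
    finally have "\<kappa> * (?F m x + ?F (Suc m) x) \<le> C0 * \<theta>\<^sup>2 / m" .
    moreover have "\<kappa> * R m x / m \<le> 2 * C0 * \<theta>\<^sup>2 / m"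
      using \<kappa>R by (rule divide_right_mono) simp
    moreover have "3 * C0 * \<theta>\<^sup>2 / m \<le> 1 / m"
      using \<theta> by (rule divide_right_mono) simp
    ultimately have main: "\<kappa> * (?F m x + ?F (Suc m) x) + \<kappa> * R m x / m \<le> 1 / m"
      by linarith
    show "(1 - 1 / m) * c x \<le> heat \<delta> c x - \<epsilon>\<^sup>2 / 2 * (heat \<delta> f x + f x)"
      unfolding Pc PR c_def \<kappa>_def[symmetric] using main by (simp add: algebra_simps)
  qed
qed

end

lemma one_minus_cos_le: "1 - cos t \<le> t\<^sup>2 / (2::real)"
proof -
  have "cos t = 1 - 2 * (sin (t / 2))\<^sup>2"
    using cos_double_sin[of "t / 2"] by simp
  moreover have "(sin (t / 2))\<^sup>2 \<le> (t / 2)\<^sup>2"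
    using abs_sin_x_le_abs_x[of "t / 2"] by (simp only: abs_le_square_iff)
  ultimately show ?thesis by (simp add: power2_eq_square)
qed

lemma abs_sin_minus_le: "\<bar>sin t - t\<bar> \<le> \<bar>t\<bar> ^ 3 / (6::real)"
  using Maclaurin_sin_bound[of t 3]
  by (simp add: eval_nat_numeral sin_coeff_def divide_simps)

definition phase :: "real \<Rightarrow> (real \<Rightarrow> real) \<Rightarrow> (real \<Rightarrow> real) \<Rightarrow> real \<Rightarrow> complex" where
  "phase \<epsilon> f c x = c x * cis (\<epsilon> * f x)"

context
  fixes f c :: "real \<Rightarrow> real" and \<epsilon> \<eta> :: real
  assumes fm [measurable]: "f \<in> borel_measurable borel" and f: "\<And>x. 0 \<le> f x" "\<And>x. f x \<le> 1"
    and cm [measurable]: "c \<in> borel_measurable borel" and c: "\<And>x. 1 - \<eta> \<le> c x" "\<And>x. c x \<le> 1"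
    and \<eta>: "\<eta> < 1" and \<epsilon>: "0 \<le> \<epsilon>" "\<epsilon> \<le> 1"
begin

lemma amplitude_pos: "0 < c x"
  using c(1)[of x] \<eta> by linarith

lemma norm_phase: "norm (phase \<epsilon> f c x) = c x"
  using amplitude_pos[of x] by (simp add: phase_def norm_mult)

lemma norm_phase_le_1: "norm (phase \<epsilon> f c x) \<le> 1"
  using c(2) by (simp add: norm_phase)

lemma measurable_phase [measurable]: "phase \<epsilon> f c \<in> borel_measurable borel"
proof -
  have "cis \<in> borel_measurable borel"
    by (intro borel_measurable_continuous_onI continuous_intros)
  note [measurable] = measurable_compose[OF _ this]
  show ?thesis
    unfolding phase_def [abs_def] by measurable
qed

text \<open>
  Rotating by the phase at \<open>x\<close>, the modulus is at least the mean of \<open>c (x + y) * cos (\<epsilon> * (f (x + y) - f x))\<close>.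
  The quadratic loss is dominated by a function linear in \<open>f\<close> since \<open>(a - b)\<^sup>2 \<le> a + b\<close> for \<open>a\<close> and \<open>b\<close> in the unit interval.
\<close>
lemma norm_heat_phase_ge:
  assumes \<delta>: "0 < \<delta>"
  shows "heat \<delta> c x - \<epsilon>\<^sup>2 / 2 * (heat \<delta> f x + f x) \<le> norm (heat \<delta> (phase \<epsilon> f c) x)"
proof -
  interpret prob_space "gauss \<delta>" using \<delta> by (rule prob_space_gauss)
  have c1: "\<bar>c x\<bar> \<le> 1" for x using amplitude_pos[of x] c(2)[of x] by simp
  have int: "integrable (gauss \<delta>) (\<lambda>y. phase \<epsilon> f c (x + y))"
    using \<delta> norm_phase_le_1 by (intro integrable_gauss[where C = 1]) auto
  have intf: "integrable (gauss \<delta>) (\<lambda>y. f (x + y))"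
    using \<delta> f by (intro integrable_gauss[where C = 1]) auto
  have intc: "integrable (gauss \<delta>) (\<lambda>y. c (x + y))"
    using \<delta> c1 by (intro integrable_gauss[where C = 1]) auto
  have "heat \<delta> c x - \<epsilon>\<^sup>2 / 2 * (heat \<delta> f x + f x)
      = (\<integral>y. c (x + y) - \<epsilon>\<^sup>2 / 2 * (f (x + y) + f x) \<partial>gauss \<delta>)"
    unfolding heat_def using intf intc prob_space by simp
  also have "\<dots> \<le> (\<integral>y. Re (cis (- \<epsilon> * f x) * phase \<epsilon> f c (x + y)) \<partial>gauss \<delta>)"
  proof (rule integral_mono)
    show "integrable (gauss \<delta>) (\<lambda>y. c (x + y) - \<epsilon>\<^sup>2 / 2 * (f (x + y) + f x))"
      using intf intc by simp
    show "integrable (gauss \<delta>) (\<lambda>y. Re (cis (- \<epsilon> * f x) * phase \<epsilon> f c (x + y)))"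
      using int by (intro integrable_Re integrable_mult_right)
    fix y
    define a b where "a = f (x + y)" and "b = f x"
    have ab: "0 \<le> a" "a \<le> 1" "0 \<le> b" "b \<le> 1"
      using f by (auto simp: a_def b_def)
    have "(a - b)\<^sup>2 \<le> a\<^sup>2 + b\<^sup>2"
      using ab by (simp add: power2_eq_square algebra_simps)
    also have "a\<^sup>2 + b\<^sup>2 \<le> a + b"
      using ab by (intro add_mono) (auto simp: power2_eq_square intro: mult_left_le)
    finally have "\<epsilon>\<^sup>2 / 2 * (a - b)\<^sup>2 \<le> \<epsilon>\<^sup>2 / 2 * (a + b)"
      by (rule mult_left_mono) simp
    then have 1: "1 - cos (\<epsilon> * (a - b)) \<le> \<epsilon>\<^sup>2 / 2 * (a + b)"
      using one_minus_cos_le[of "\<epsilon> * (a - b)"] by (simp add: power_mult_distrib)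
    have "c (x + y) * (1 - cos (\<epsilon> * (a - b))) \<le> 1 * (1 - cos (\<epsilon> * (a - b)))"
      using c(2) by (intro mult_right_mono) auto
    moreover have "Re (cis (- \<epsilon> * f x) * phase \<epsilon> f c (x + y)) = c (x + y) * cos (\<epsilon> * (a - b))"
      by (simp add: phase_def a_def b_def right_diff_distrib cos_diff algebra_simps)
    moreover have "c (x + y) * (1 - cos (\<epsilon> * (a - b))) = c (x + y) - c (x + y) * cos (\<epsilon> * (a - b))"
      by (simp add: right_diff_distrib)
    ultimately show "c (x + y) - \<epsilon>\<^sup>2 / 2 * (f (x + y) + f x) \<le> Re (cis (- \<epsilon> * f x) * phase \<epsilon> f c (x + y))"
      using 1 unfolding a_def b_def mult_1_left by linarith
  qed
  also have "\<dots> = Re (cis (- \<epsilon> * f x) * heat \<delta> (phase \<epsilon> f c) x)"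
    unfolding heat_def using int by simp
  also have "\<dots> \<le> norm (cis (- \<epsilon> * f x) * heat \<delta> (phase \<epsilon> f c) x)"
    by (rule complex_Re_le_cmod)
  also have "\<dots> = norm (heat \<delta> (phase \<epsilon> f c) x)"
    by (simp add: norm_mult)
  finally show ?thesis .
qed

lemma heat_phase_Re:
  assumes r: "0 < r"
  shows "1 - (\<eta> + \<epsilon>\<^sup>2) \<le> Re (heat r (phase \<epsilon> f c) x)" "Re (heat r (phase \<epsilon> f c) x) \<le> 1"
proof -
  have int: "integrable (gauss r) (\<lambda>y. phase \<epsilon> f c (x + y))"
    using r norm_phase_le_1 by (intro integrable_gauss[where C = 1]) auto
  show "Re (heat r (phase \<epsilon> f c) x) \<le> 1"
    using complex_Re_le_cmod norm_heat_le[OF r measurable_phase norm_phase_le_1] by (rule order_trans)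
  have "1 - (\<eta> + \<epsilon>\<^sup>2) = (\<integral>y. 1 - (\<eta> + \<epsilon>\<^sup>2) \<partial>gauss r)"
    using heat_const[OF r, of "1 - (\<eta> + \<epsilon>\<^sup>2)" x] by (simp add: heat_def)
  also have "\<dots> \<le> (\<integral>y. Re (phase \<epsilon> f c (x + y)) \<partial>gauss r)"
  proof (rule integral_mono)
    show "integrable (gauss r) (\<lambda>y. 1 - (\<eta> + \<epsilon>\<^sup>2))"
      using integrable_gauss[OF r, of "\<lambda>_. 1 - (\<eta> + \<epsilon>\<^sup>2)"] by auto
    show "integrable (gauss r) (\<lambda>y. Re (phase \<epsilon> f c (x + y)))"
      using int by (rule integrable_Re)
    fix y
    define z where "z = x + y"
    have "(\<epsilon> * f z)\<^sup>2 \<le> (\<epsilon> * 1)\<^sup>2"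
      using f \<epsilon> by (intro power_mono mult_left_mono) auto
    then have "1 - cos (\<epsilon> * f z) \<le> \<epsilon>\<^sup>2"
      using one_minus_cos_le[of "\<epsilon> * f z"] zero_le_power2[of \<epsilon>] unfolding mult_1_right by linarith
    moreover have "c z * (1 - cos (\<epsilon> * f z)) \<le> 1 * (1 - cos (\<epsilon> * f z))"
      using c(2) by (intro mult_right_mono) auto
    ultimately have "1 - (\<eta> + \<epsilon>\<^sup>2) \<le> c z * cos (\<epsilon> * f z)"
      using c(1)[of z] by (simp add: right_diff_distrib)
    then show "1 - (\<eta> + \<epsilon>\<^sup>2) \<le> Re (phase \<epsilon> f c (x + y))"
      by (simp add: phase_def z_def)
  qed
  also have "\<dots> = Re (heat r (phase \<epsilon> f c) x)"
    unfolding heat_def using int by simp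
  finally show "1 - (\<eta> + \<epsilon>\<^sup>2) \<le> Re (heat r (phase \<epsilon> f c) x)" .
qed

text \<open>
  To first order in \<open>\<epsilon>\<close> the phase is \<open>1 + i \<epsilon> f\<close>. The error of the imaginary part has to be
  small compared with \<open>\<epsilon>\<close>; for the real part the distance of \<open>c\<close> from \<open>1\<close> gives a fixed small constant only.
\<close>
lemma heat_phase_Im:
  assumes r: "0 < r"
  shows "\<bar>Im (heat r (phase \<epsilon> f c) x) - \<epsilon> * heat r f x\<bar> \<le> \<epsilon> * (\<eta> + \<epsilon>\<^sup>2)"
proof -
  have int: "integrable (gauss r) (\<lambda>y. phase \<epsilon> f c (x + y))"
    using r norm_phase_le_1 by (intro integrable_gauss[where C = 1]) auto
  have intf: "integrable (gauss r) (\<lambda>y. f (x + y))"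
    using r f by (intro integrable_gauss[where C = 1]) auto
  have bound: "\<bar>Im (phase \<epsilon> f c z) - \<epsilon> * f z\<bar> \<le> \<epsilon> * (\<eta> + \<epsilon>\<^sup>2)" for z
  proof -
    have t: "0 \<le> \<epsilon> * f z" "\<epsilon> * f z \<le> \<epsilon>"
      using f[of z] \<epsilon> by (auto intro: mult_left_le)
    have "\<bar>c z * (sin (\<epsilon> * f z) - \<epsilon> * f z)\<bar> \<le> 1 * (\<bar>\<epsilon> * f z\<bar> ^ 3 / 6)"
      unfolding abs_mult using amplitude_pos[of z] c(2)[of z] abs_sin_minus_le[of "\<epsilon> * f z"]
      by (intro mult_mono) (auto simp: abs_mult)
    also have "\<dots> \<le> \<epsilon> ^ 3"
      using power_mono[OF t(2,1), of 3] zero_le_power[OF \<epsilon>(1), of 3] unfolding abs_of_nonneg[OF t(1)] by linarith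
    finally have 1: "\<bar>c z * (sin (\<epsilon> * f z) - \<epsilon> * f z)\<bar> \<le> \<epsilon> ^ 3" .
    have 2: "\<bar>(c z - 1) * (\<epsilon> * f z)\<bar> \<le> \<eta> * \<epsilon>"
      unfolding abs_mult[of "c z - 1"] using c[of z] t by (intro mult_mono) auto
    have "Im (phase \<epsilon> f c z) - \<epsilon> * f z = c z * (sin (\<epsilon> * f z) - \<epsilon> * f z) + (c z - 1) * (\<epsilon> * f z)"
      by (simp add: phase_def algebra_simps)
    then have "\<bar>Im (phase \<epsilon> f c z) - \<epsilon> * f z\<bar> \<le> \<epsilon> ^ 3 + \<eta> * \<epsilon>"
      using 1 2 by linarith
    then show ?thesis by (simp add: power2_eq_square power3_eq_cube algebra_simps)
  qed
  have "Im (heat r (phase \<epsilon> f c) x) - \<epsilon> * heat r f x = heat r (\<lambda>z. Im (phase \<epsilon> f c z) - \<epsilon> * f z) x"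
    unfolding heat_def using int intf by simp
  also have "\<bar>\<dots>\<bar> \<le> \<epsilon> * (\<eta> + \<epsilon>\<^sup>2)"
    unfolding real_norm_def[symmetric] by (rule norm_heat_le[OF r]) (auto simp: bound)
  finally show ?thesis .
qed

end

lemma Im_mult_approx:
  assumes "1 - e \<le> Re z1" "Re z1 \<le> 1" "\<bar>Im z1 - \<epsilon> * g1\<bar> \<le> \<epsilon> * e"
    and "1 - e \<le> Re z2" "Re z2 \<le> 1" "\<bar>Im z2 - \<epsilon> * g2\<bar> \<le> \<epsilon> * e"
    and "0 \<le> g1" "g1 \<le> 1" "0 \<le> g2" "g2 \<le> 1" "0 \<le> \<epsilon>" "e \<le> 1"
  shows "\<bar>Im (z1 * z2) - \<epsilon> * (g1 + g2)\<bar> \<le> 4 * \<epsilon> * e"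
proof -
  have *: "\<bar>a * b - \<epsilon> * g\<bar> \<le> 2 * \<epsilon> * e"
    if "1 - e \<le> a" "a \<le> 1" "\<bar>b - \<epsilon> * g\<bar> \<le> \<epsilon> * e" "0 \<le> g" "g \<le> 1" for a b g
  proof -
    have 1: "\<bar>a * (b - \<epsilon> * g)\<bar> \<le> 1 * (\<epsilon> * e)"
      unfolding abs_mult using that assms(12) by (intro mult_mono) auto
    have 2: "\<bar>(a - 1) * (\<epsilon> * g)\<bar> \<le> e * (\<epsilon> * 1)"
      unfolding abs_mult using that assms(11) by (intro mult_mono mult_left_mono) (auto intro: mult_left_mono)
    have 3: "a * b - \<epsilon> * g = a * (b - \<epsilon> * g) + (a - 1) * (\<epsilon> * g)"
      by (simp add: algebra_simps)
    have "e * (\<epsilon> * 1) = \<epsilon> * e" "1 * (\<epsilon> * e) = \<epsilon> * e" "2 * \<epsilon> * e = \<epsilon> * e + \<epsilon> * e" by simp_all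
    then show ?thesis using 1 2 unfolding 3 by linarith
  qed
  have "Im (z1 * z2) - \<epsilon> * (g1 + g2) = (Re z1 * Im z2 - \<epsilon> * g2) + (Re z2 * Im z1 - \<epsilon> * g1)"
    by (simp add: algebra_simps)
  then show ?thesis
    using *[of "Re z1" "Im z2" g2] *[of "Re z2" "Im z1" g1] assms by linarith
qed

section \<open>The window functional\<close>

text \<open>
  A chain run to the right and a chain run to the left, glued at any gap of the grid; \<open>\<phi>\<close> occurs at both ends.
\<close>
definition window :: "(real \<Rightarrow> complex) \<Rightarrow> (real \<Rightarrow> complex) \<Rightarrow> nat \<Rightarrow> (nat \<Rightarrow> real) \<Rightarrow> complex" where
  "window w \<phi> n b = \<phi> (b 0) * (\<Prod>i\<in>{1..<n}. w (b i)) * \<phi> (b n)"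

lemma window_eq_chains:
  assumes "j < n"
  shows "window w \<phi> n b = chain w \<phi> j (\<lambda>i. b (j - i)) * chain w \<phi> (n - 1 - j) (\<lambda>i. b (j + 1 + i))"
proof -
  have 1: "(\<Prod>i<j. w (b (j - i))) = (\<Prod>i\<in>{1..j}. w (b i))"
    by (rule prod.reindex_bij_witness[where i = "\<lambda>i. j - i" and j = "\<lambda>i. j - i"]) auto
  have 2: "(\<Prod>i<n - 1 - j. w (b (j + 1 + i))) = (\<Prod>i\<in>{j+1..<n}. w (b i))"
    using assms by (intro prod.reindex_bij_witness[where i = "\<lambda>i. i - (j + 1)" and j = "\<lambda>i. j + 1 + i"]) auto
  have "{1..<n} = {1..j} \<union> {j+1..<n}" using assms by auto
  then have "(\<Prod>i\<in>{1..<n}. w (b i)) = (\<Prod>i\<in>{1..j}. w (b i)) * (\<Prod>i\<in>{j+1..<n}. w (b i))"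
    using prod.union_disjoint[of "{1..j}" "{j+1..<n}" "\<lambda>i. w (b i)"] by fastforce
  moreover have "j + 1 + (n - 1 - j) = n" using assms by simp
  ultimately show ?thesis
    unfolding window_def chain_def 1 2 by (simp add: mult.assoc mult.left_commute)
qed

lemma norm_window_le:
  assumes "\<And>x. norm (w x) \<le> K" "\<And>x. norm (\<phi> x) \<le> 1"
  shows "norm (window w \<phi> n b) \<le> K ^ (n - 1)"
proof -
  have "norm (\<Prod>i\<in>{1..<n}. w (b i)) \<le> (\<Prod>i\<in>{1..<n}. K)"
    unfolding prod_norm[symmetric] using assms(1) by (intro prod_mono) auto
  also have "\<dots> = K ^ (n - 1)" by simp
  finally have *: "norm (\<Prod>i\<in>{1..<n}. w (b i)) \<le> K ^ (n - 1)" .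
  have "norm (\<phi> (b 0)) * norm (\<Prod>i\<in>{1..<n}. w (b i)) * norm (\<phi> (b n))
      \<le> 1 * K ^ (n - 1) * 1"
    using * assms(2) order_trans[OF norm_ge_zero *] by (intro mult_mono) auto
  then show ?thesis by (simp add: window_def norm_mult)
qed

lemma measurable_window:
  assumes [measurable]: "w \<in> borel_measurable borel" "\<phi> \<in> borel_measurable borel"
    and [measurable]: "\<And>i. (\<lambda>z. Y z i) \<in> borel_measurable N"
  shows "(\<lambda>z. window w \<phi> n (Y z)) \<in> borel_measurable N"
  unfolding window_def by measurable

context prob_space
begin

lemma window_expectation:
  fixes r \<delta> :: real and j n :: nat
  assumes B: "two_sided_brownian_motion B" and r: "0 < r" "r < \<delta>" and j: "j < n"
    and "w \<in> borel_measurable borel" "\<phi> \<in> borel_measurable borel"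
    and "\<And>x. norm (w x) \<le> K" "\<And>x. norm (\<phi> x) \<le> 1"
    and "\<And>x. w x * heat \<delta> \<phi> x = \<phi> x"
  shows "(\<integral>\<omega>. window w \<phi> n (\<lambda>i. B (- (r + j * \<delta>) + i * \<delta>) \<omega>) \<partial>M)
    = (\<integral>\<omega>. heat r \<phi> (B 0 \<omega>) * heat (\<delta> - r) \<phi> (B 0 \<omega>) \<partial>M)"
proof -
  have "window w \<phi> n (\<lambda>i. B (- (r + j * \<delta>) + i * \<delta>) \<omega>)
      = chain w \<phi> j (\<lambda>i. B (- (r + i * \<delta>)) \<omega>) * chain w \<phi> (n - 1 - j) (\<lambda>i. B (\<delta> - r + i * \<delta>) \<omega>)" for \<omega>
  proof -
    have 1: "- (r + j * \<delta>) + (j - i) * \<delta> = - (r + i * \<delta>)" if "i \<le> j" for i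
      using that by (simp add: of_nat_diff algebra_simps)
    have 2: "- (r + j * \<delta>) + (j + 1 + i) * \<delta> = \<delta> - r + i * \<delta>" for i :: nat
      by (simp add: algebra_simps)
    show ?thesis
      unfolding window_eq_chains[OF j] 2
      by (intro arg_cong2[where f = "(*)"] chain_cong) (simp_all only: 1)
  qed
  then show ?thesis
    using two_sided_chain_expectation[OF B r(1) _ _ assms(5-9), of "\<delta> - r" j "n - 1 - j"] r by simp
qed

text \<open>
  The window of \<open>n\<close> steps starting at time \<open>u\<close> has the origin in the gap after its point number \<open>j\<close>, at distance \<open>r\<close> from it;
  the formula for the mean does not involve \<open>j\<close>, so one bound on \<open>0 < r < \<delta>\<close> serves all windows. The finitely many
  \<open>u\<close> with the origin on the grid are negligible.
\<close>
lemma window_shift_bound: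
  fixes \<delta> :: real and n :: nat
  assumes B: "two_sided_brownian_motion B" and T [measurable]: "T \<in> borel_measurable M"
    and X: "two_sided_brownian_motion (\<lambda>t \<omega>. B (T \<omega> + t) \<omega>)" and T0: "AE \<omega> in M. 0 \<le> T \<omega>"
    and \<delta>: "0 < \<delta>" and n: "0 < n"
    and w\<phi> [measurable]: "w \<in> borel_measurable borel" "\<phi> \<in> borel_measurable borel"
    and K: "\<And>x. norm (w x) \<le> K" "\<And>x. norm (\<phi> x) \<le> 1"
    and harm: "\<And>x. w x * heat \<delta> \<phi> x = \<phi> x"
    and q: "\<And>r. 0 < r \<Longrightarrow> r < \<delta> \<Longrightarrow>
      q \<le> Im (\<integral>\<omega>. heat r \<phi> (B 0 \<omega>) * heat (\<delta> - r) \<phi> (B 0 \<omega>) \<partial>M)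
          - Im (\<integral>\<omega>. heat r \<phi> (B (T \<omega>) \<omega>) * heat (\<delta> - r) \<phi> (B (T \<omega>) \<omega>) \<partial>M)"
  shows "q * (n * \<delta>) \<le> 2 * K ^ (n - 1) * (\<integral>\<omega>. min (T \<omega>) (n * \<delta>) \<partial>M)"
proof -
  obtain B' where B': "\<And>t. B' t \<in> borel_measurable M" "\<And>\<omega>. continuous_on UNIV (\<lambda>t. B' t \<omega>)"
    "AE \<omega> in M. \<forall>t. B' t \<omega> = B t \<omega>"
    by (rule two_sided_brownian_motion_continuous_version[OF B]) blast
  have joint: "(\<lambda>p. B' (fst p) (snd p)) \<in> borel_measurable (borel \<Otimes>\<^sub>M M)"
    by (rule measurable_continuous_paths[OF B'(1,2)])
  have joint': "(\<lambda>z. B' (g z) (h z)) \<in> borel_measurable N"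
    if [measurable]: "g \<in> borel_measurable N" "h \<in> measurable N M" for g h N
    using measurable_compose[OF _ joint, of "\<lambda>z. (g z, h z)" N] by simp
  define \<Psi> where "\<Psi> u \<omega> = window w \<phi> n (\<lambda>i. B' (u + i * \<delta>) \<omega>)" for u \<omega>
  have m1: "(\<lambda>\<omega>. \<Psi> u \<omega>) \<in> borel_measurable M" for u
    unfolding \<Psi>_def by (intro measurable_window w\<phi> B'(1))
  have m2: "(\<lambda>\<omega>. \<Psi> (T \<omega> + u) \<omega>) \<in> borel_measurable M" for u
    unfolding \<Psi>_def by (intro measurable_window w\<phi> joint') auto
  have bnd: "norm (\<Psi> u \<omega>) \<le> K ^ (n - 1)" for u \<omega>
    unfolding \<Psi>_def using K by (rule norm_window_le)
  show ?thesis
  proof (rule shift_comparison[where \<psi> = "\<lambda>u \<omega>. Im (\<Psi> u \<omega>)"])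
    show "(\<lambda>p. Im (\<Psi> (fst p) (snd p))) \<in> borel_measurable (borel \<Otimes>\<^sub>M M)"
      unfolding \<Psi>_def by (intro measurable_compose[OF _ borel_measurable_Im] measurable_window w\<phi> joint') auto
    show "\<bar>Im (\<Psi> u \<omega>)\<bar> \<le> K ^ (n - 1)" for u \<omega>
      using abs_Im_le_cmod bnd by (rule order_trans)
    have "{- (k * \<delta>) |k. k \<in> {0..n}} \<in> null_sets lborel"
      by (intro finite_imp_null_set_lborel) auto
    then show "AE u in lborel. u \<in> {- (n * \<delta>)..0} \<longrightarrow>
        q \<le> (\<integral>\<omega>. Im (\<Psi> u \<omega>) \<partial>M) - (\<integral>\<omega>. Im (\<Psi> (T \<omega> + u) \<omega>) \<partial>M)"
    proof (rule eventually_mono[OF AE_not_in], intro impI)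
      fix u assume grid: "u \<notin> {- (k * \<delta>) |k. k \<in> {0..n}}" and u: "u \<in> {- (n * \<delta>)..0}"
      define j where "j = nat \<lfloor>- u / \<delta>\<rfloor>"
      define r where "r = - u - j * \<delta>"
      have nn: "0 \<le> - u / \<delta>" using u \<delta> by (simp add: divide_nonpos_pos)
      have jle: "real j \<le> - u / \<delta>" "- u / \<delta> < real j + 1"
        using nn unfolding j_def by linarith+
      then have le: "real j * \<delta> \<le> - u" "- u < (real j + 1) * \<delta>"
        using \<delta> by (auto simp: pos_le_divide_eq pos_divide_less_eq simp del: divide_minus_left)
      have "real j * \<delta> \<le> n * \<delta>" using le u by simp
      then have "j \<le> n" using \<delta> by simp
      then have neq: "u \<noteq> - (j * \<delta>)" using grid by auto
      have "u \<noteq> - (n * \<delta>)" using grid by auto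
      then have "real j * \<delta> < n * \<delta>" using le u by auto
      then have j: "j < n" using \<delta> by simp
      have r: "0 < r" "r < \<delta>"
        using le neq unfolding r_def by (auto simp: algebra_simps less_le)
      have u_eq: "u = - (r + j * \<delta>)" by (simp add: r_def)
      have "(\<integral>\<omega>. \<Psi> u \<omega> \<partial>M) = (\<integral>\<omega>. window w \<phi> n (\<lambda>i. B (u + i * \<delta>) \<omega>) \<partial>M)"
        using B'(3) two_sided_brownian_motion_measurable[OF B]
        by (intro integral_cong_AE m1 measurable_window w\<phi>) (auto simp: \<Psi>_def)
      also have "\<dots> = (\<integral>\<omega>. heat r \<phi> (B 0 \<omega>) * heat (\<delta> - r) \<phi> (B 0 \<omega>) \<partial>M)"
        unfolding u_eq by (rule window_expectation) (use B r j w\<phi> K harm in auto)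
      finally have 1: "(\<integral>\<omega>. \<Psi> u \<omega> \<partial>M) = (\<integral>\<omega>. heat r \<phi> (B 0 \<omega>) * heat (\<delta> - r) \<phi> (B 0 \<omega>) \<partial>M)" .
      have "(\<integral>\<omega>. \<Psi> (T \<omega> + u) \<omega> \<partial>M) = (\<integral>\<omega>. window w \<phi> n (\<lambda>i. B (T \<omega> + (u + i * \<delta>)) \<omega>) \<partial>M)"
        using B'(3) two_sided_brownian_motion_measurable[OF X]
        by (intro integral_cong_AE m2 measurable_window w\<phi>) (auto simp: \<Psi>_def add.assoc)
      also have "\<dots> = (\<integral>\<omega>. heat r \<phi> (B (T \<omega> + 0) \<omega>) * heat (\<delta> - r) \<phi> (B (T \<omega> + 0) \<omega>) \<partial>M)"
        unfolding u_eq by (rule window_expectation[where B = "\<lambda>t \<omega>. B (T \<omega> + t) \<omega>"]) (use X r j w\<phi> K harm in auto)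
      finally have 2: "(\<integral>\<omega>. \<Psi> (T \<omega> + u) \<omega> \<partial>M)
          = (\<integral>\<omega>. heat r \<phi> (B (T \<omega>) \<omega>) * heat (\<delta> - r) \<phi> (B (T \<omega>) \<omega>) \<partial>M)" by simp
      have "(\<integral>\<omega>. Im (\<Psi> u \<omega>) \<partial>M) = Im (\<integral>\<omega>. \<Psi> u \<omega> \<partial>M)"
        using m1 bnd by (intro integral_Im integrable_bounded)
      moreover have "(\<integral>\<omega>. Im (\<Psi> (T \<omega> + u) \<omega>) \<partial>M) = Im (\<integral>\<omega>. \<Psi> (T \<omega> + u) \<omega> \<partial>M)"
        using m2 bnd by (intro integral_Im integrable_bounded)
      ultimately show "q \<le> (\<integral>\<omega>. Im (\<Psi> u \<omega>) \<partial>M) - (\<integral>\<omega>. Im (\<Psi> (T \<omega> + u) \<omega>) \<partial>M)"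
        using q[OF r] 1 2 by simp
    qed
  qed (use T0 \<delta> n in auto)
qed

end

lemma min_le_powr:
  assumes "0 \<le> t" "0 \<le> (s::real)"
  shows "min t s \<le> t powr (1 / 4) * s powr (3 / 4)"
proof -
  define x where "x = min t s"
  have x: "0 \<le> x" using assms by (simp add: x_def)
  have "x = x powr (1 / 4) * x powr (3 / 4)"
    using x by (simp add: powr_add[symmetric] powr_one)
  also have "\<dots> \<le> t powr (1 / 4) * s powr (3 / 4)"
    using x by (intro mult_mono powr_mono2) (auto simp: x_def)
  finally show ?thesis by (simp add: x_def)
qed

text \<open>
  The dominating function is \<open>\<delta> powr (3/4) * T powr (1/4)\<close>, from the interpolation \<open>min t s \<le> t powr (1/4) * s powr (3/4)\<close>.
\<close>
lemma (in prob_space) truncated_mean_tendsto_0: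
  fixes T :: "'a \<Rightarrow> real"
  assumes T [measurable]: "T \<in> borel_measurable M" and T0: "AE \<omega> in M. 0 \<le> T \<omega>"
    and fin: "integrable M (\<lambda>\<omega>. T \<omega> powr (1 / 4))" and \<delta>: "0 < \<delta>"
  shows "(\<lambda>m. (\<integral>\<omega>. min (T \<omega>) (real m * \<delta>) \<partial>M) / real m powr (3 / 4)) \<longlonglongrightarrow> 0"
proof -
  have "(\<lambda>m. \<integral>\<omega>. min (T \<omega>) (real m * \<delta>) / real m powr (3 / 4) \<partial>M) \<longlonglongrightarrow> (\<integral>\<omega>. 0 \<partial>M)"
  proof (rule integral_dominated_convergence)
    show "integrable M (\<lambda>\<omega>. \<delta> powr (3 / 4) * T \<omega> powr (1 / 4))"
      using fin by simp
    show "AE \<omega> in M. (\<lambda>m. min (T \<omega>) (real m * \<delta>) / real m powr (3 / 4)) \<longlonglongrightarrow> 0"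
      using T0
    proof eventually_elim
      case (elim \<omega>)
      have "(\<lambda>m. real m powr (- (3 / 4))) \<longlonglongrightarrow> 0"
        by (intro tendsto_neg_powr filterlim_real_sequentially) simp
      then have 1: "(\<lambda>m. T \<omega> * real m powr (- (3 / 4))) \<longlonglongrightarrow> 0"
        by (rule tendsto_mult_right_zero)
      show ?case
      proof (rule tendsto_sandwich[OF _ _ tendsto_const 1])
        show "\<forall>\<^sub>F m in sequentially. 0 \<le> min (T \<omega>) (real m * \<delta>) / real m powr (3 / 4)"
          using elim \<delta> by (intro always_eventually) auto
        show "\<forall>\<^sub>F m in sequentially. min (T \<omega>) (real m * \<delta>) / real m powr (3 / 4) \<le> T \<omega> * real m powr (- (3 / 4))"
        proof (rule always_eventually, rule allI)
          fix m
          have "min (T \<omega>) (real m * \<delta>) / real m powr (3 / 4) \<le> T \<omega> / real m powr (3 / 4)"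
            by (rule divide_right_mono) simp_all
          then show "min (T \<omega>) (real m * \<delta>) / real m powr (3 / 4) \<le> T \<omega> * real m powr (- (3 / 4))"
            by (simp only: powr_minus divide_inverse)
        qed
      qed
    qed
    show "AE \<omega> in M. norm (min (T \<omega>) (real m * \<delta>) / real m powr (3 / 4)) \<le> \<delta> powr (3 / 4) * T \<omega> powr (1 / 4)" for m
      using T0
    proof eventually_elim
      case (elim \<omega>)
      have "min (T \<omega>) (real m * \<delta>) \<le> T \<omega> powr (1 / 4) * (real m * \<delta>) powr (3 / 4)"
        using elim \<delta> by (intro min_le_powr) auto
      also have "\<dots> = (\<delta> powr (3 / 4) * T \<omega> powr (1 / 4)) * real m powr (3 / 4)"
        using \<delta> by (simp add: powr_mult)
      finally have "min (T \<omega>) (real m * \<delta>) / real m powr (3 / 4) \<le> \<delta> powr (3 / 4) * T \<omega> powr (1 / 4)"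
        by (cases "m = 0") (auto simp: pos_divide_le_eq)
      moreover have "0 \<le> min (T \<omega>) (real m * \<delta>)" using elim \<delta> by simp
      ultimately show ?case by simp
    qed
  qed measurable
  then show ?thesis by simp
qed

section \<open>Growth of the truncated mean of the shift\<close>

lemma (in real_distribution) heat_Lipschitz_mean:
  fixes f :: "real \<Rightarrow> real"
  assumes r: "0 < r" and [measurable]: "f \<in> borel_measurable borel" and C: "\<And>x. \<bar>f x\<bar> \<le> C"
    and L: "\<And>x y. \<bar>f x - f y\<bar> \<le> L * \<bar>x - y\<bar>"
  shows "\<bar>(\<integral>x. heat r f x \<partial>M) - (\<integral>x. f x \<partial>M)\<bar> \<le> L * sqrt r"
proof -
  have mf: "f \<in> borel_measurable M" "heat r f \<in> borel_measurable M"
    using r by (simp_all add: measurable_heat)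
  have int: "integrable M f" "integrable M (heat r f)"
    using mf C norm_heat_le[OF r assms(2), of C]
    by (auto intro!: integrable_bounded[where C = C])
  then have "(\<integral>x. heat r f x \<partial>M) - (\<integral>x. f x \<partial>M) = (\<integral>x. heat r f x - f x \<partial>M)"
    by simp
  also have "\<bar>\<dots>\<bar> \<le> (\<integral>x. \<bar>heat r f x - f x\<bar> \<partial>M)"
    by (rule integral_abs_bound)
  also have "\<dots> \<le> (\<integral>x. L * sqrt r \<partial>M)"
    using int heat_Lipschitz_approx[OF r assms(2) C L] by (intro integral_mono) auto
  also have "\<dots> = L * sqrt r"
    using prob_space by simp
  finally show ?thesis .
qed

lemma (in real_distribution) Im_phase_product_mean:
  assumes fm [measurable]: "f \<in> borel_measurable borel" and f: "\<And>x. 0 \<le> f x" "\<And>x. f x \<le> 1"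
    and cm: "c \<in> borel_measurable borel" and c: "\<And>x. 1 - \<eta> \<le> c x" "\<And>x. c x \<le> 1"
    and \<eta>: "\<eta> < 1" "\<eta> + \<epsilon>\<^sup>2 \<le> 1" and \<epsilon>: "0 \<le> \<epsilon>" "\<epsilon> \<le> 1" and r: "0 < r" "0 < s"
  shows "\<bar>Im (\<integral>x. heat r (phase \<epsilon> f c) x * heat s (phase \<epsilon> f c) x \<partial>M)
      - \<epsilon> * ((\<integral>x. heat r f x \<partial>M) + (\<integral>x. heat s f x \<partial>M))\<bar> \<le> 4 * \<epsilon> * (\<eta> + \<epsilon>\<^sup>2)"
proof -
  let ?\<phi> = "phase \<epsilon> f c"
  have \<phi>: "?\<phi> \<in> borel_measurable borel" "\<And>x. norm (?\<phi> x) \<le> 1"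
    using measurable_phase norm_phase_le_1 assms by blast+
  have hm [measurable]: "heat r ?\<phi> \<in> borel_measurable borel" "heat s ?\<phi> \<in> borel_measurable borel"
    "heat r f \<in> borel_measurable borel" "heat s f \<in> borel_measurable borel"
    using \<phi>(1) r by (auto intro: measurable_heat)
  have f1: "\<bar>f x\<bar> \<le> 1" for x using f by simp
  have g: "0 \<le> heat t f x" "heat t f x \<le> 1" if "0 < t" for t x
    using norm_heat_le[OF that fm, of 1 x] f f1
    by (auto simp: heat_def intro: Bochner_Integration.integral_nonneg)
  have intg: "integrable M (heat r f)" "integrable M (heat s f)"
    using g r by (auto intro!: integrable_bounded[where C = 1])
  have "norm (heat r ?\<phi> x * heat s ?\<phi> x) \<le> 1 * 1" for x
    unfolding norm_mult using norm_heat_le[OF _ \<phi>] r by (intro mult_mono) auto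
  then have int: "integrable M (\<lambda>x. heat r ?\<phi> x * heat s ?\<phi> x)"
    by (intro integrable_bounded[where C = 1]) auto
  have diff: "Im (\<integral>x. heat r ?\<phi> x * heat s ?\<phi> x \<partial>M) - \<epsilon> * ((\<integral>x. heat r f x \<partial>M) + (\<integral>x. heat s f x \<partial>M))
      = (\<integral>x. Im (heat r ?\<phi> x * heat s ?\<phi> x) - \<epsilon> * (heat r f x + heat s f x) \<partial>M)"
    using int intg by (simp only: integral_Im Bochner_Integration.integral_diff Bochner_Integration.integral_add
        Bochner_Integration.integral_mult_right integrable_Im integrable_mult_right Bochner_Integration.integrable_add)
  have "\<bar>\<integral>x. Im (heat r ?\<phi> x * heat s ?\<phi> x) - \<epsilon> * (heat r f x + heat s f x) \<partial>M\<bar>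
      \<le> (\<integral>x. \<bar>Im (heat r ?\<phi> x * heat s ?\<phi> x) - \<epsilon> * (heat r f x + heat s f x)\<bar> \<partial>M)"
    by (rule integral_abs_bound)
  also have "\<dots> \<le> (\<integral>x. 4 * \<epsilon> * (\<eta> + \<epsilon>\<^sup>2) \<partial>M)"
  proof (rule integral_mono)
    show "integrable M (\<lambda>x. \<bar>Im (heat r ?\<phi> x * heat s ?\<phi> x) - \<epsilon> * (heat r f x + heat s f x)\<bar>)"
      using int intg by (intro integrable_abs Bochner_Integration.integrable_diff integrable_Im
          integrable_mult_right Bochner_Integration.integrable_add)
    show "\<bar>Im (heat r ?\<phi> x * heat s ?\<phi> x) - \<epsilon> * (heat r f x + heat s f x)\<bar> \<le> 4 * \<epsilon> * (\<eta> + \<epsilon>\<^sup>2)" for x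
      using g r \<epsilon> \<eta> heat_phase_Re[OF fm f cm c \<eta>(1) \<epsilon>] heat_phase_Im[OF fm f cm c \<eta>(1) \<epsilon>]
      by (intro Im_mult_approx) auto
  qed simp
  also have "\<dots> = 4 * \<epsilon> * (\<eta> + \<epsilon>\<^sup>2)"
    using prob_space by simp
  finally show ?thesis unfolding diff .
qed

lemma power_ratio_le_3:
  assumes "2 \<le> (m::nat)"
  shows "(1 / (1 - 1 / real m)) ^ (m - 1) \<le> 3"
proof -
  have "1 / (1 - 1 / real m) = 1 + 1 / real (m - 1)"
    using assms by (simp add: of_nat_diff field_simps)
  also have "\<dots> \<le> exp (1 / real (m - 1))"
    by (rule exp_ge_add_one_self)
  finally have "(1 / (1 - 1 / real m)) ^ (m - 1) \<le> exp (1 / real (m - 1)) ^ (m - 1)"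
    using assms by (intro power_mono) auto
  also have "\<dots> = exp 1"
    using assms by (simp add: exp_of_nat_mult[symmetric])
  finally show ?thesis using exp_le by linarith
qed

text \<open>
  The constants are chosen in the order \<open>f\<close>, \<open>\<delta>\<close>, \<open>\<theta>\<close>, independently of \<open>m\<close>; only \<open>\<epsilon>\<close> and the amplitude depend on \<open>m\<close>.
  The two means differ by about \<open>\<epsilon>\<close> while the window lasts for a time \<open>m * \<delta>\<close>, whence the order
  \<open>\<epsilon> * m = \<theta> * m powr (3/4)\<close>.
\<close>
lemma (in prob_space) truncated_mean_lower_bound:
  assumes B: "two_sided_brownian_motion B" and T: "unbiased_shift B T" and T0: "AE \<omega> in M. 0 \<le> T \<omega>"
    and sing: "mutually_singular (distr M borel (B 0)) (distr M borel (\<lambda>\<omega>. B (T \<omega>) \<omega>))"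
  obtains \<delta> \<rho> where "0 < \<delta>" "0 < \<rho>"
    "\<And>m. 2 \<le> m \<Longrightarrow> \<rho> * real m powr (3 / 4) \<le> (\<integral>\<omega>. min (T \<omega>) (real m * \<delta>) \<partial>M)"
proof -
  define \<mu> where "\<mu> = distr M borel (B 0)"
  define \<nu> where "\<nu> = distr M borel (\<lambda>\<omega>. B (T \<omega>) \<omega>)"
  have Tm: "T \<in> borel_measurable M" and X: "two_sided_brownian_motion (\<lambda>t \<omega>. B (T \<omega> + t) \<omega>)"
    using T by (auto simp: unbiased_shift_def)
  have mB: "B 0 \<in> borel_measurable M" "(\<lambda>\<omega>. B (T \<omega>) \<omega>) \<in> borel_measurable M"
    using two_sided_brownian_motion_measurable[OF B, of 0] two_sided_brownian_motion_measurable[OF X, of 0]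
    by simp_all
  interpret \<mu>: real_distribution \<mu> unfolding \<mu>_def by (rule real_distribution_distr[OF mB(1)])
  interpret \<nu>: real_distribution \<nu> unfolding \<nu>_def by (rule real_distribution_distr[OF mB(2)])
  obtain f :: "real \<Rightarrow> real" and L where f: "integrable lborel f" "\<And>x. 0 \<le> f x" "\<And>x. f x \<le> 1"
    and L: "\<And>x y. \<bar>f x - f y\<bar> \<le> L * \<bar>x - y\<bar>" and gap: "(\<integral>x. f x \<partial>\<nu>) + 1 / 4 \<le> (\<integral>x. f x \<partial>\<mu>)"
    using separating_Lipschitz_function[OF \<mu>.real_distribution_axioms \<nu>.real_distribution_axioms
        sing[folded \<mu>_def \<nu>_def]] by blast
  have fm: "f \<in> borel_measurable borel" using f(1) by auto
  have f1: "\<bar>f x\<bar> \<le> 1" for x using f by simp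
  have "0 \<le> L" using L[of 0 1] by auto
  \<comment> \<open>averaging over times below \<open>\<delta>\<close> changes each of the two integrals by at most \<open>1 / 32\<close>; \<open>L + 1\<close> covers \<open>L = 0\<close>\<close>
  define \<delta> where "\<delta> = (1 / (32 * (L + 1)))\<^sup>2"
  have \<delta>: "0 < \<delta>" using \<open>0 \<le> L\<close> by (simp add: \<delta>_def)
  have L\<delta>: "L * sqrt r \<le> 1 / 32" if "r < \<delta>" for r
  proof -
    have "L * sqrt r \<le> L * sqrt \<delta>"
      using that \<open>0 \<le> L\<close> by (intro mult_left_mono) auto
    also have "\<dots> = L / (32 * (L + 1))"
      using \<open>0 \<le> L\<close> by (simp add: \<delta>_def real_sqrt_abs)
    also have "\<dots> \<le> 1 / 32"
      using \<open>0 \<le> L\<close> by (simp add: divide_simps)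
    finally show ?thesis .
  qed
  have gap_r: "(\<integral>x. heat r f x \<partial>\<nu>) + 3 / 16 \<le> (\<integral>x. heat r f x \<partial>\<mu>)" if r: "0 < r" "r < \<delta>" for r
    using \<mu>.heat_Lipschitz_mean[OF r(1) fm f1 L] \<nu>.heat_Lipschitz_mean[OF r(1) fm f1 L] gap L\<delta>[OF r(2)]
    by linarith
  define C0 where "C0 = 1 + 2 * ((\<integral>x. f x \<partial>lborel) / sqrt (2 * pi * \<delta>))"
  have C0: "1 \<le> C0" by (rule decay_constant_ge_1[OF f \<delta> C0_def])
  \<comment> \<open>this makes the relative error \<open>2 * C0 * \<theta>\<^sup>2 + \<epsilon>\<^sup>2\<close> at most \<open>1 / 64\<close>, small against the gap \<open>3 / 8\<close>\<close>
  define \<theta> where "\<theta> = sqrt (1 / (192 * C0))"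
  have \<theta>: "0 < \<theta>" "C0 * \<theta>\<^sup>2 = 1 / 192" "\<theta>\<^sup>2 \<le> 1 / 192"
    using C0 by (auto simp: \<theta>_def field_simps)
  have bound: "\<delta> * \<theta> / 24 * real m powr (3 / 4) \<le> (\<integral>\<omega>. min (T \<omega>) (real m * \<delta>) \<partial>M)" if m: "2 \<le> m" for m :: nat
  proof -
    define \<epsilon> where "\<epsilon> = \<theta> / real m powr (1 / 4)"
    have mpos: "0 < real m powr (1 / 4)" "1 \<le> real m powr (1 / 4)"
      using m by (auto intro: ge_one_powr_ge_zero)
    have "(real m powr (1 / 4))\<^sup>2 = sqrt (real m)"
      using m by (simp add: power2_eq_square powr_add[symmetric] powr_half_sqrt)
    then have \<epsilon>2: "\<epsilon>\<^sup>2 = \<theta>\<^sup>2 / sqrt (real m)"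
      by (simp add: \<epsilon>_def power_divide)
    have "\<epsilon> \<le> \<theta> / 1"
      unfolding \<epsilon>_def using mpos \<theta>(1) by (intro divide_left_mono) auto
    then have \<epsilon>\<theta>: "\<epsilon> \<le> \<theta>" by simp
    have \<epsilon>0: "0 < \<epsilon>" using \<theta>(1) mpos by (simp add: \<epsilon>_def)
    have \<epsilon>2le: "\<epsilon>\<^sup>2 \<le> 1 / 192"
      using power_mono[OF \<epsilon>\<theta>, of 2] \<epsilon>0 \<theta>(3) by linarith
    have \<epsilon>1: "\<epsilon> \<le> 1"
      by (rule power2_le_imp_le) (use \<epsilon>2le in auto)
    define \<eta> where "\<eta> = 2 * C0 * \<theta>\<^sup>2"
    have \<eta>: "\<eta> = 2 / 192" using \<theta>(2) by (simp add: \<eta>_def)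
    have "3 * C0 * \<theta>\<^sup>2 \<le> 1" "0 < m" using \<theta>(2) m by auto
    then obtain c where c: "c \<in> borel_measurable borel" "\<And>x. 1 - \<eta> \<le> c x" "\<And>x. c x \<le> 1"
      "\<And>x. (1 - 1 / m) * c x \<le> heat \<delta> c x - \<epsilon>\<^sup>2 / 2 * (heat \<delta> f x + f x)"
      unfolding \<eta>_def using exists_damping[OF f \<delta> C0_def _ _ \<epsilon>2] by blast
    have \<eta>1: "\<eta> < 1" using \<eta> by simp
    define \<phi> where "\<phi> = phase \<epsilon> f c"
    have \<phi>m: "\<phi> \<in> borel_measurable borel"
      unfolding \<phi>_def using measurable_phase[OF fm f(2,3) c(1,2,3) \<eta>1] \<epsilon>0 \<epsilon>1 by simp
    have n\<phi>: "norm (\<phi> x) = c x" "norm (\<phi> x) \<le> 1" for x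
      unfolding \<phi>_def using norm_phase[OF fm f(2,3) c(1,2,3) \<eta>1] c(3) \<epsilon>0 \<epsilon>1 by simp_all
    have cpos: "0 < c x" for x
      using c(2)[of x] \<eta>1 by linarith
    have lower: "(1 - 1 / m) * c x \<le> norm (heat \<delta> \<phi> x)" for x
      unfolding \<phi>_def
      using c(4) norm_heat_phase_ge[OF fm f(2,3) c(1,2,3) \<eta>1 less_imp_le[OF \<epsilon>0] \<epsilon>1 \<delta>] by (rule order_trans)
    have a: "0 < 1 - 1 / real m" using m by simp
    have nz: "heat \<delta> \<phi> x \<noteq> 0" for x
      using lower[of x] mult_pos_pos[OF a cpos[of x]] by auto
    define w where "w x = \<phi> x / heat \<delta> \<phi> x" for x
    have wm: "w \<in> borel_measurable borel"
      unfolding w_def [abs_def] by (rule borel_measurable_divide[OF \<phi>m measurable_heat[OF \<delta> \<phi>m]])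
    have wK: "norm (w x) \<le> 1 / (1 - 1 / m)" for x
      using lower[of x] a nz[of x] by (simp add: w_def norm_divide n\<phi>(1) divide_simps mult.commute)
    have harm: "w x * heat \<delta> \<phi> x = \<phi> x" for x
      using nz by (simp add: w_def)
    have small: "4 * \<epsilon> * (\<eta> + \<epsilon>\<^sup>2) \<le> \<epsilon> / 16"
    proof -
      have "4 * \<epsilon> * (\<eta> + \<epsilon>\<^sup>2) \<le> 4 * \<epsilon> * (1 / 64)"
        using \<eta> \<epsilon>2le \<epsilon>0 by (intro mult_left_mono) auto
      then show ?thesis by simp
    qed
    have signal: "\<epsilon> / 4 \<le> Im (\<integral>\<omega>. heat r \<phi> (B 0 \<omega>) * heat (\<delta> - r) \<phi> (B 0 \<omega>) \<partial>M)
          - Im (\<integral>\<omega>. heat r \<phi> (B (T \<omega>) \<omega>) * heat (\<delta> - r) \<phi> (B (T \<omega>) \<omega>) \<partial>M)"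
      if r: "0 < r" "r < \<delta>" for r
    proof -
      have s: "0 < \<delta> - r" "\<delta> - r < \<delta>" using r by auto
      have hm: "(\<lambda>x. heat r \<phi> x * heat (\<delta> - r) \<phi> x) \<in> borel_measurable borel"
        using \<phi>m r by (intro borel_measurable_times measurable_heat) auto
      have 1: "(\<integral>\<omega>. heat r \<phi> (B 0 \<omega>) * heat (\<delta> - r) \<phi> (B 0 \<omega>) \<partial>M) = (\<integral>x. heat r \<phi> x * heat (\<delta> - r) \<phi> x \<partial>\<mu>)"
        unfolding \<mu>_def by (rule integral_distr[OF mB(1) hm, symmetric])
      have 2: "(\<integral>\<omega>. heat r \<phi> (B (T \<omega>) \<omega>) * heat (\<delta> - r) \<phi> (B (T \<omega>) \<omega>) \<partial>M) = (\<integral>x. heat r \<phi> x * heat (\<delta> - r) \<phi> x \<partial>\<nu>)"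
        unfolding \<nu>_def by (rule integral_distr[OF mB(2) hm, symmetric])
      have e1: "\<eta> + \<epsilon>\<^sup>2 \<le> 1" using \<eta> \<epsilon>2le by simp
      have "\<epsilon> * (((\<integral>x. heat r f x \<partial>\<nu>) + (\<integral>x. heat (\<delta> - r) f x \<partial>\<nu>)) + 3 / 8)
          \<le> \<epsilon> * ((\<integral>x. heat r f x \<partial>\<mu>) + (\<integral>x. heat (\<delta> - r) f x \<partial>\<mu>))"
        using gap_r[OF r] gap_r[OF s] \<epsilon>0 by (intro mult_left_mono) auto
      then have "\<epsilon> * ((\<integral>x. heat r f x \<partial>\<nu>) + (\<integral>x. heat (\<delta> - r) f x \<partial>\<nu>)) + \<epsilon> * (3 / 8)
          \<le> \<epsilon> * ((\<integral>x. heat r f x \<partial>\<mu>) + (\<integral>x. heat (\<delta> - r) f x \<partial>\<mu>))"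
        by (simp only: distrib_left)
      then show ?thesis
        unfolding 1 2 unfolding \<phi>_def
        using \<mu>.Im_phase_product_mean[OF fm f(2,3) c(1,2,3) \<eta>1 e1 less_imp_le[OF \<epsilon>0] \<epsilon>1 r(1) s(1)]
          \<nu>.Im_phase_product_mean[OF fm f(2,3) c(1,2,3) \<eta>1 e1 less_imp_le[OF \<epsilon>0] \<epsilon>1 r(1) s(1)] small
        by linarith
    qed
    define I where "I = (\<integral>\<omega>. min (T \<omega>) (real m * \<delta>) \<partial>M)"
    have I0: "0 \<le> I"
      unfolding I_def using T0 \<delta> by (intro Bochner_Integration.integral_nonneg_AE) auto
    have "\<epsilon> / 4 * (real m * \<delta>) \<le> 2 * (1 / (1 - 1 / real m)) ^ (m - 1) * I"
      unfolding I_def by (rule window_shift_bound[OF B Tm X T0 \<delta> _ wm \<phi>m wK n\<phi>(2) harm signal]) (use m in auto)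
    also have "\<dots> \<le> 2 * 3 * I"
      using power_ratio_le_3[OF m] I0 by (intro mult_right_mono mult_left_mono) auto
    finally have main: "\<epsilon> / 4 * (real m * \<delta>) \<le> 6 * I" by simp
    have "real m = real m powr (3 / 4) * real m powr (1 / 4)"
      using m by (simp add: powr_add[symmetric])
    then have "real m / real m powr (1 / 4) = real m powr (3 / 4)"
      using mpos(1) by (simp add: field_simps)
    then have "\<epsilon> * real m = \<theta> * real m powr (3 / 4)"
      unfolding \<epsilon>_def by (metis times_divide_eq_left times_divide_eq_right)
    then have "\<epsilon> / 4 * (real m * \<delta>) = 6 * (\<delta> * \<theta> / 24 * real m powr (3 / 4))"
      by (simp add: field_simps)
    with main show ?thesis unfolding I_def by linarith
  qed
  show thesis
    by (rule that[OF \<delta> _ bound]) (use \<delta> \<theta>(1) in auto)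
qed

theorem mainTheorem2:
  fixes M :: "'a measure" and B :: "real \<Rightarrow> 'a \<Rightarrow> real" and T :: "'a \<Rightarrow> real"
    and \<mu> \<nu> :: "real measure"
  assumes "prob_space M"
    and "real_distribution \<mu>" and "real_distribution \<nu>"
    and "mutually_singular \<mu> \<nu>"
    and "prob_space.two_sided_brownian_motion M B"
    and "distr M borel (B 0) = \<mu>"
    and "prob_space.unbiased_shift M B T"
    and "AE \<omega> in M. 0 \<le> T \<omega>"
    and "distr M borel (\<lambda>\<omega>. B (T \<omega>) \<omega>) = \<nu>"
  shows "(\<integral>\<^sup>+ \<omega>. ennreal (T \<omega> powr (1 / 4)) \<partial>M) = \<infinity>"
proof (rule ccontr)
  interpret prob_space M by fact
  assume "\<not> ?thesis"
  then have fin: "(\<integral>\<^sup>+ \<omega>. ennreal (T \<omega> powr (1 / 4)) \<partial>M) < \<infinity>"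
    by (simp add: less_top)
  have Tm [measurable]: "T \<in> borel_measurable M"
    using assms(7) by (simp add: unbiased_shift_def)
  have "integrable M (\<lambda>\<omega>. T \<omega> powr (1 / 4))"
    using fin by (intro integrableI_nonneg) auto
  obtain \<delta> \<rho> where \<delta>: "0 < \<delta>" and \<rho>: "0 < \<rho>"
    and bound: "\<And>m. 2 \<le> m \<Longrightarrow> \<rho> * real m powr (3 / 4) \<le> (\<integral>\<omega>. min (T \<omega>) (real m * \<delta>) \<partial>M)"
    using truncated_mean_lower_bound[OF assms(5,7,8)] assms(4,6,9) by blast
  have "(\<lambda>m. (\<integral>\<omega>. min (T \<omega>) (real m * \<delta>) \<partial>M) / real m powr (3 / 4)) \<longlonglongrightarrow> 0"
    using truncated_mean_tendsto_0[OF Tm assms(8) _ \<delta>] \<open>integrable M _\<close> by simp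
  moreover have "\<rho> \<le> (\<integral>\<omega>. min (T \<omega>) (real m * \<delta>) \<partial>M) / real m powr (3 / 4)" if "2 \<le> m" for m
    using bound[OF that] that by (simp add: pos_le_divide_eq)
  ultimately have "\<rho> \<le> 0"
    by (intro LIMSEQ_le_const) auto
  with \<rho> show False by simp
qed

end
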